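(* Let $\rho>0$, let $\sigma_1,\sigma_2\in W^{1,1}(0,T;\mathbb R^{3\times3}_{\rm sym})$, and for $i=1,2$ let $(\varepsilon_{0,i},z_{0,i})\in S_{\sigma_i}(0)$ and let $(\varepsilon_i,z_i)$ be an energetic solution corresponding to $\sigma_i$ and to the initial datum $(\varepsilon_{0,i},z_{0,i})$. Then there exists a positive constant $c$, depending only on $\alpha$, on the bound and the Lipschitz constant of $\nabla^2W_\rho$, and on $\|\sigma_i\|_{W^{1,1}(0,T;\mathbb R^{3\times3}_{\rm sym})}$ for $i=1,2$, such that for all $t\in[0,T]$ $$|(\varepsilon_1-\varepsilon_2)(t)|^2+|(z_1-z_2)(t)|^2\le c\Big(|\varepsilon_{0,1}-\varepsilon_{0,2}|^2+|z_{0,1}-z_{0,2}|^2+\|\sigma_1-\sigma_2\|^2_{W^{1,1}(0,t;\mathbb R^{3\times3}_{\rm sym})}\Big).$$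
   Context: $\mathbb R^{3\times3}_{\rm sym}$ is the space of symmetric $3\times3$ matrices with $a:b=\mathrm{tr}(ab)$ and norm $|\cdot|$; $\mathbb R^{3\times3}_{\rm dev}$ is its trace-free subspace. $\mathbb C:\mathbb R^{3\times3}_{\rm sym}\to\mathbb R^{3\times3}_{\rm sym}$ is linear, symmetric, positive definite, and leaves $\mathbb R^{3\times3}_{\rm dev}$ and $\mathbb R 1_2$ invariant. $c_2>0$; for $\rho>0$, $F_\rho:\mathbb R^{3\times3}_{\rm dev}\to[0,\infty)$ is $C^{2,1}$ with $\nabla^2F_\rho$ bounded and Lipschitz, $\nabla^2F_\rho\ge c_2\,\mathrm{Id}$ and $F_\rho(0)=0$. $W_\rho(\varepsilon,z)=\frac12\mathbb C(\varepsilon-z):(\varepsilon-z)+F_\rho(z)$; hence $\nabla^2W_\rho$ is bounded and Lipschitz. $\alpha>0$ is the ellipticity constant of the quadratic form: $\frac12\mathbb C(\varepsilon-z):(\varepsilon-z)+c_2|z|^2\ge\alpha(|\varepsilon|^2+|z|^2)$. $D:\mathbb R^{3\times3}_{\rm dev}\to[0,\infty)$ is lower semicontinuous, positively 1-homogeneous, satisfies $D(b+c)\le D(b)+D(c)$ and $D(a)\ge c_D|a|$ for some $c_D>0$. $\mathrm{Diss}_D(z,[s,t])=\sup\sum_{i=1}^ND(z(t_i)-z(t_{i-1}))$ over all finite partitions of $[s,t]$. For $\sigma\in W^{1,1}(0,T;\mathbb R^{3\times3}_{\rm sym})$: $S_\sigma(t)=\{(\varepsilon,z): W_\rho(\varepsilon,z)-\sigma(t):\varepsilon\le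 W_\rho(\bar\varepsilon,\bar z)-\sigma(t):\bar\varepsilon+D(\bar z-z)\ \forall(\bar\varepsilon,\bar z)\in\mathbb R^{3\times3}_{\rm sym}\times\mathbb R^{3\times3}_{\rm dev}\}$. An energetic solution corresponding to $\sigma$ and $(\varepsilon_0,z_0)$ is a map $(\varepsilon,z):[0,T]\to\mathbb R^{3\times3}_{\rm sym}\times\mathbb R^{3\times3}_{\rm dev}$ with $(\varepsilon(0),z(0))=(\varepsilon_0,z_0)$, $\dot\sigma:\varepsilon$ integrable, and for all $t\in[0,T]$: $(\varepsilon(t),z(t))\in S_\sigma(t)$ and $W_\rho(\varepsilon(t),z(t))-\sigma(t):\varepsilon(t)+\mathrm{Diss}_D(z,[0,t])=W_\rho(\varepsilon_0,z_0)-\sigma(0):\varepsilon_0-\int_0^t\dot\sigma:\varepsilon\,ds$. *)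

theory Defs
  imports "HOL-Analysis.Analysis"
begin

section \<open>Symmetric and deviatoric matrices\<close>

text \<open>The library norm and inner product on \<^typ>\<open>real^3^3\<close> are the Frobenius ones; for symmetric
  matrices the inner product is \<open>a : b = tr (a b)\<close>, see \<open>inner_eq_trace\<close> below.\<close>

type_synonym mat3 = "real^3^3"

definition Msym :: "mat3 set"
  where "Msym = {a. transpose a = a}"

definition Mdev :: "mat3 set"
  where "Mdev = {a \<in> Msym. trace a = 0}"

lemma inner_eq_trace:
  assumes "b \<in> Msym"
  shows "a \<bullet> b = trace (a ** b)"
proof -
  have "b $ k $ i = b $ i $ k" for i k
    using assms unfolding Msym_def transpose_def by (auto simp: vec_eq_iff)
  then show ?thesis
    by (simp add: inner_vec_def trace_def matrix_matrix_mult_def)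
qed

section \<open>Twice differentiable functions on a subspace\<close>

text \<open>\<open>f\<close> is only relevant on the linear subspace \<open>V\<close>. \<open>G\<close> is its gradient, taken in \<open>V\<close>, and \<open>H x\<close>
  the Hessian at \<open>x\<close>, regarded as an operator. Derivatives within \<open>V\<close> determine \<open>H x h\<close> uniquely
  for \<open>h \<in> V\<close>, and only these values are used below.\<close>

definition has_hessian_on :: "('a::euclidean_space \<Rightarrow> real) \<Rightarrow> ('a \<Rightarrow> 'a \<Rightarrow> 'a) \<Rightarrow> 'a set \<Rightarrow> bool"
  where "has_hessian_on f H V \<longleftrightarrow>
    (\<exists>G. \<forall>x\<in>V. G x \<in> V \<and> (f has_derivative (\<lambda>h. G x \<bullet> h)) (at x within V)
            \<and> (G has_derivative H x) (at x within V))"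

definition hessian_bound :: "('a::euclidean_space \<Rightarrow> 'a \<Rightarrow> 'a) \<Rightarrow> 'a set \<Rightarrow> real \<Rightarrow> bool"
  where "hessian_bound H V M \<longleftrightarrow> (\<forall>x\<in>V. \<forall>h\<in>V. norm (H x h) \<le> M * norm h)"

definition hessian_lipschitz :: "('a::euclidean_space \<Rightarrow> 'a \<Rightarrow> 'a) \<Rightarrow> 'a set \<Rightarrow> real \<Rightarrow> bool"
  where "hessian_lipschitz H V L \<longleftrightarrow>
    (\<forall>x\<in>V. \<forall>y\<in>V. \<forall>h\<in>V. norm (H x h - H y h) \<le> L * norm (x - y) * norm h)"

section \<open>Material data\<close>

definition elasticity_tensor :: "(mat3 \<Rightarrow> mat3) \<Rightarrow> bool"
  where "elasticity_tensor C \<longleftrightarrow>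
    (\<forall>a\<in>Msym. C a \<in> Msym) \<and>
    (\<forall>a\<in>Msym. \<forall>b\<in>Msym. C (a + b) = C a + C b) \<and>
    (\<forall>a\<in>Msym. \<forall>r. C (r *\<^sub>R a) = r *\<^sub>R C a) \<and>
    (\<forall>a\<in>Msym. \<forall>b\<in>Msym. C a \<bullet> b = a \<bullet> C b) \<and>
    (\<forall>a\<in>Msym. a \<noteq> 0 \<longrightarrow> 0 < C a \<bullet> a) \<and>
    (\<forall>a\<in>Mdev. C a \<in> Mdev) \<and>
    (\<forall>a\<in>range (\<lambda>r. r *\<^sub>R (mat 1 :: mat3)). C a \<in> range (\<lambda>r. r *\<^sub>R (mat 1 :: mat3)))"

definition hardening_potential :: "real \<Rightarrow> (mat3 \<Rightarrow> real) \<Rightarrow> bool"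
  where "hardening_potential c2 F \<longleftrightarrow>
    (\<forall>z\<in>Mdev. 0 \<le> F z) \<and> F 0 = 0 \<and>
    (\<exists>H. has_hessian_on F H Mdev \<and>
         (\<exists>M. hessian_bound H Mdev M) \<and> (\<exists>L. hessian_lipschitz H Mdev L) \<and>
         (\<forall>z\<in>Mdev. \<forall>h\<in>Mdev. c2 * (norm h)\<^sup>2 \<le> H z h \<bullet> h))"

definition energy :: "(mat3 \<Rightarrow> mat3) \<Rightarrow> (mat3 \<Rightarrow> real) \<Rightarrow> mat3 \<times> mat3 \<Rightarrow> real"
  where "energy C F = (\<lambda>(e, z). 1/2 * (C (e - z) \<bullet> (e - z)) + F z)"

definition ellipticity_constant :: "(mat3 \<Rightarrow> mat3) \<Rightarrow> real \<Rightarrow> real \<Rightarrow> bool"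
  where "ellipticity_constant C c2 \<alpha> \<longleftrightarrow> 0 < \<alpha> \<and>
    (\<forall>e\<in>Msym. \<forall>z\<in>Mdev.
       \<alpha> * ((norm e)\<^sup>2 + (norm z)\<^sup>2) \<le> 1/2 * (C (e - z) \<bullet> (e - z)) + c2 * (norm z)\<^sup>2)"

definition dissipation_potential :: "(mat3 \<Rightarrow> real) \<Rightarrow> bool"
  where "dissipation_potential D \<longleftrightarrow>
    (\<forall>a\<in>Mdev. 0 \<le> D a) \<and>
    (\<forall>a\<in>Mdev. \<forall>r<D a. eventually (\<lambda>b. r < D b) (at a within Mdev)) \<and>
    (\<forall>a\<in>Mdev. \<forall>r>0. D (r *\<^sub>R a) = r * D a) \<and>
    (\<forall>b\<in>Mdev. \<forall>c\<in>Mdev. D (b + c) \<le> D b + D c) \<and>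
    (\<exists>cD>0. \<forall>a\<in>Mdev. cD * norm a \<le> D a)"

text \<open>The partition points are \<open>p 0, \<dots>, p N\<close>; repeated points contribute \<open>D 0 = 0\<close>.\<close>

definition Diss :: "(mat3 \<Rightarrow> real) \<Rightarrow> (real \<Rightarrow> mat3) \<Rightarrow> real \<Rightarrow> real \<Rightarrow> ereal"
  where "Diss D z s t =
    (SUP (N, p) \<in> {(N :: nat, p :: nat \<Rightarrow> real). p 0 = s \<and> p N = t \<and> (\<forall>i<N. p i \<le> p (Suc i))}.
       ereal (\<Sum>i=1..N. D (z (p i) - z (p (i - 1)))))"

section \<open>The Sobolev space \<open>W\<^sup>1\<^sup>,\<^sup>1\<close>\<close>

text \<open>Test functions are \<open>C\<^sup>1\<close> with compact support in \<open>(0,T)\<close>; smooth ones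
  would define the same weak derivatives.\<close>

definition test_function :: "real \<Rightarrow> (real \<Rightarrow> real) \<Rightarrow> (real \<Rightarrow> real) \<Rightarrow> bool"
  where "test_function T \<phi> \<phi>' \<longleftrightarrow>
    (\<forall>s. (\<phi> has_real_derivative \<phi>' s) (at s)) \<and> continuous_on UNIV \<phi>' \<and>
    (\<exists>K. compact K \<and> K \<subseteq> {0<..<T} \<and> (\<forall>s. s \<notin> K \<longrightarrow> \<phi> s = 0))"

definition weak_derivative :: "real \<Rightarrow> (real \<Rightarrow> 'a::euclidean_space) \<Rightarrow> (real \<Rightarrow> 'a) \<Rightarrow> bool"
  where "weak_derivative T u g \<longleftrightarrow>
    (\<forall>\<phi> \<phi>'. test_function T \<phi> \<phi>' \<longrightarrow>
       integral {0..T} (\<lambda>s. \<phi>' s *\<^sub>R u s) = - integral {0..T} (\<lambda>s. \<phi> s *\<^sub>R g s))"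

text \<open>\<open>\<sigma>\<close> is the continuous representative of an element of \<open>W\<^sup>1\<^sup>,\<^sup>1(0,T; Msym)\<close>, which gives meaning to
  the values \<open>\<sigma> t\<close>, and \<open>\<sigma>'\<close> represents its weak derivative. The predicate and all uses of \<open>\<sigma>'\<close> below
  do not depend on the choice of \<open>\<sigma>'\<close> up to null sets.\<close>

definition W11_sym :: "real \<Rightarrow> (real \<Rightarrow> mat3) \<Rightarrow> (real \<Rightarrow> mat3) \<Rightarrow> bool"
  where "W11_sym T \<sigma> \<sigma>' \<longleftrightarrow>
    continuous_on {0..T} \<sigma> \<and> \<sigma>' absolutely_integrable_on {0..T} \<and>
    (\<forall>s\<in>{0..T}. \<sigma> s \<in> Msym \<and> \<sigma>' s \<in> Msym) \<and> weak_derivative T \<sigma> \<sigma>'"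

text \<open>The norm of \<open>u\<close> in \<open>W\<^sup>1\<^sup>,\<^sup>1(0,t)\<close>, where \<open>g\<close> is the weak derivative of \<open>u\<close>.\<close>

definition W11_norm :: "real \<Rightarrow> (real \<Rightarrow> 'a::euclidean_space) \<Rightarrow> (real \<Rightarrow> 'a) \<Rightarrow> real"
  where "W11_norm t u g = integral {0..t} (\<lambda>s. norm (u s)) + integral {0..t} (\<lambda>s. norm (g s))"

section \<open>Energetic solutions\<close>

text \<open>The stable set \<open>S\<^sub>\<sigma>(t)\<close> is \<open>stable_set C F D (\<sigma> t)\<close>.\<close>

definition stable_set ::
    "(mat3 \<Rightarrow> mat3) \<Rightarrow> (mat3 \<Rightarrow> real) \<Rightarrow> (mat3 \<Rightarrow> real) \<Rightarrow> mat3 \<Rightarrow> (mat3 \<times> mat3) set"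
  where "stable_set C F D \<tau> =
    {(e, z) \<in> Msym \<times> Mdev. \<forall>e'\<in>Msym. \<forall>z'\<in>Mdev.
       energy C F (e, z) - \<tau> \<bullet> e \<le> energy C F (e', z') - \<tau> \<bullet> e' + D (z' - z)}"

text \<open>The energy balance is an identity in the extended reals; it forces \<open>Diss D z 0 t\<close> to be finite.\<close>

definition energetic_solution ::
    "(mat3 \<Rightarrow> mat3) \<Rightarrow> (mat3 \<Rightarrow> real) \<Rightarrow> (mat3 \<Rightarrow> real) \<Rightarrow> real \<Rightarrow>
     (real \<Rightarrow> mat3) \<Rightarrow> (real \<Rightarrow> mat3) \<Rightarrow> mat3 \<Rightarrow> mat3 \<Rightarrow> (real \<Rightarrow> mat3) \<Rightarrow> (real \<Rightarrow> mat3) \<Rightarrow> bool"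
  where "energetic_solution C F D T \<sigma> \<sigma>' e0 z0 e z \<longleftrightarrow>
    (\<forall>t\<in>{0..T}. e t \<in> Msym \<and> z t \<in> Mdev) \<and>
    e 0 = e0 \<and> z 0 = z0 \<and>
    (\<lambda>s. \<sigma>' s \<bullet> e s) absolutely_integrable_on {0..T} \<and>
    (\<forall>t\<in>{0..T}.
       (e t, z t) \<in> stable_set C F D (\<sigma> t) \<and>
       ereal (energy C F (e t, z t) - \<sigma> t \<bullet> e t) + Diss D z 0 t
         = ereal (energy C F (e0, z0) - \<sigma> 0 \<bullet> e0 - integral {0..t} (\<lambda>s. \<sigma>' s \<bullet> e s)))"

end

theory Submission
  imports Defs
begin

text \<open>
  Write \<open>y = (\<epsilon>, z)\<close> and \<open>l = (\<sigma>, 0)\<close>. Stability says that the driving force \<open>l - \<nabla>W y\<close> is admissible, i.e.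
  bounded by \<open>D\<close>, and the energy balance that along the increments of \<open>y\<close> it attains the bound up to an
  error quadratic in \<open>\<integral> \<bar>l'\<bar>\<close>; strong convexity also gives \<open>\<bar>y t - y s\<bar> \<le> (2/\<alpha>) \<integral>\<^sub>s\<^sup>t \<bar>l'\<bar>\<close>. Testing each solution with
  the force of the other one, the gap \<open>\<gamma> = (\<nabla>W y1 - \<nabla>W y2) \<bullet> (y1 - y2) \<ge> \<alpha> \<bar>y1 - y2\<bar>\<^sup>2\<close> satisfies
  \<open>d\<gamma> \<le> 2 (l1 - l2) \<bullet> d(y1 - y2) + (2L/\<alpha>) \<bar>y1 - y2\<bar>\<^sup>2 (\<bar>l1'\<bar> + \<bar>l2'\<bar>) dt\<close>,
  where the Lipschitz continuity and the symmetry of \<open>\<nabla>\<^sup>2W\<close> enter. Gronwall's argument finishes the proof. It is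
  run on increments instead of derivatives: a function whose increments are bounded by the squared increments
  of a continuous monotone function is nonincreasing, so no differentiability almost everywhere is
  needed. The initial loads, which the \<open>W\<^sup>1\<^sup>,\<^sup>1(0,t)\<close> norm does not control uniformly for small \<open>t\<close>, are
  gradients of \<open>W\<close> at the initial data by stability.
\<close>

section \<open>Calculus on a subspace\<close>

text \<open>A line through \<open>x\<close> with direction \<open>h\<close> in \<open>V\<close>
  never leaves \<open>V\<close>, so a derivative within \<open>V\<close> yields an ordinary
  derivative in the real parameter. This reduces the calculus on \<open>V\<close> to one
  variable.\<close>

lemma has_derivative_compose_line:
  fixes g :: "'a::real_normed_vector \<Rightarrow> 'b::real_normed_vector"
  assumes V: "subspace V" and x: "x \<in> V" and h: "h \<in> V"
    and g: "(g has_derivative g') (at (x + t *\<^sub>R h) within V)"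
  shows "((\<lambda>s. g (x + s *\<^sub>R h)) has_vector_derivative g' h) (at t)"
proof -
  have line: "((\<lambda>s. x + s *\<^sub>R h) has_derivative (\<lambda>s. s *\<^sub>R h)) (at t)"
    by (auto intro!: derivative_eq_intros)
  have sub: "range (\<lambda>s. x + s *\<^sub>R h) \<subseteq> V"
    using V x h by (auto intro: subspace_add subspace_scale)
  have "((g \<circ> (\<lambda>s. x + s *\<^sub>R h)) has_derivative (g' \<circ> (\<lambda>s. s *\<^sub>R h))) (at t)"
    by (rule diff_chain_within[OF line]) (use has_derivative_subset[OF g sub] in simp)
  moreover have "g' (s *\<^sub>R h) = s *\<^sub>R g' h" for s
    using has_derivative_linear[OF g] by (simp add: linear_scale)
  ultimately show ?thesis
    by (simp add: has_vector_derivative_def o_def)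
qed

text \<open>The signs of \<open>M\<close> and \<open>L\<close> are separate assumptions because the
  bounds force them only when \<open>V\<close> contains a nonzero vector.\<close>

locale smooth_on_subspace =
  fixes V :: "'a::euclidean_space set" and f :: "'a \<Rightarrow> real" and G :: "'a \<Rightarrow> 'a"
    and H :: "'a \<Rightarrow> 'a \<Rightarrow> 'a" and M L :: real
  assumes V: "subspace V"
    and f_deriv: "x \<in> V \<Longrightarrow> (f has_derivative (\<lambda>h. G x \<bullet> h)) (at x within V)"
    and G_deriv: "x \<in> V \<Longrightarrow> (G has_derivative H x) (at x within V)"
    and H_bound: "\<lbrakk>x \<in> V; h \<in> V\<rbrakk> \<Longrightarrow> norm (H x h) \<le> M * norm h"
    and H_lipschitz: "\<lbrakk>x \<in> V; y \<in> V; h \<in> V\<rbrakk> \<Longrightarrow> norm (H x h - H y h) \<le> L * norm (x - y) * norm h"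
    and M: "0 \<le> M" and L: "0 \<le> L"
begin

lemmas in_V = subspace_add[OF V] subspace_diff[OF V] subspace_scale[OF V] subspace_neg[OF V] subspace_0[OF V]

lemma f_line:
  assumes "x \<in> V" "h \<in> V"
  shows "((\<lambda>s. f (x + s *\<^sub>R h)) has_real_derivative G (x + t *\<^sub>R h) \<bullet> h) (at t)"
  using has_derivative_compose_line[OF V assms f_deriv] assms
  by (simp add: has_real_derivative_iff_has_vector_derivative in_V)

lemma G_line:
  assumes "x \<in> V" "h \<in> V"
  shows "((\<lambda>s. G (x + s *\<^sub>R h) \<bullet> k) has_real_derivative H (x + t *\<^sub>R h) h \<bullet> k) (at t)"
proof -
  have "((\<lambda>s. G (x + s *\<^sub>R h)) has_vector_derivative H (x + t *\<^sub>R h) h) (at t)"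
    using has_derivative_compose_line[OF V assms G_deriv] assms by (simp add: in_V)
  from bounded_linear.has_vector_derivative[OF bounded_linear_inner_left this]
  show ?thesis
    by (simp add: has_real_derivative_iff_has_vector_derivative)
qed

section \<open>Mean value and Taylor estimates for the gradient\<close>

text \<open>The mean value theorem fails for vector-valued maps, so the gradient is paired with a
  fixed \<open>k\<close>, on which \<open>\<xi>\<close> may depend.\<close>

lemma G_mvt:
  assumes "x \<in> V" "h \<in> V" "0 < b"
  obtains \<xi> where "0 < \<xi>" "\<xi> < b" "(G (x + b *\<^sub>R h) - G x) \<bullet> k = b * (H (x + \<xi> *\<^sub>R h) h \<bullet> k)"
proof -
  obtain \<xi> where "0 < \<xi>" "\<xi> < b"
      "G (x + b *\<^sub>R h) \<bullet> k - G (x + 0 *\<^sub>R h) \<bullet> k = (b - 0) * (H (x + \<xi> *\<^sub>R h) h \<bullet> k)"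
    using MVT2[OF \<open>0 < b\<close> G_line[OF assms(1,2)], of k] by blast
  then show ?thesis
    using that by (simp add: inner_diff_left)
qed

text \<open>Testing the mean value identity with \<open>G x - G y\<close> itself gives its squared
  norm; one factor then cancels.\<close>

lemma G_lipschitz:
  assumes "x \<in> V" "y \<in> V"
  shows "norm (G x - G y) \<le> M * norm (x - y)"
proof -
  let ?w = "G x - G y"
  obtain \<xi> where "0 < \<xi>" "\<xi> < 1" and \<xi>: "?w \<bullet> ?w = H (y + \<xi> *\<^sub>R (x - y)) (x - y) \<bullet> ?w"
    using G_mvt[of y "x - y" 1 ?w] assms by (auto simp: in_V)
  have "norm ?w * norm ?w \<le> norm (H (y + \<xi> *\<^sub>R (x - y)) (x - y)) * norm ?w"
    unfolding norm_eq_sqrt_inner[symmetric]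
    by (metis \<xi> norm_cauchy_schwarz power2_eq_square power2_norm_eq_inner)
  also have "\<dots> \<le> M * norm (x - y) * norm ?w"
    using assms by (intro mult_right_mono H_bound) (auto simp: in_V)
  finally show ?thesis
    by (cases "?w = 0") (use M in \<open>auto simp: mult_le_cancel_right\<close>)
qed

text \<open>The Hessian at the intermediate point differs from \<open>H x\<close> by at most
  \<open>L\<close> times a distance below \<open>norm h\<close>. The mean value form gives
  \<open>L\<close> rather than \<open>L / 2\<close>, which affects only the size of the final
  constant.\<close>

lemma G_taylor:
  assumes "x \<in> V" "h \<in> V"
  shows "\<bar>(G (x + h) - G x - H x h) \<bullet> k\<bar> \<le> L * (norm h)\<^sup>2 * norm k"
proof -
  obtain \<xi> where "0 < \<xi>" "\<xi> < 1" and \<xi>: "(G (x + h) - G x) \<bullet> k = H (x + \<xi> *\<^sub>R h) h \<bullet> k"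
    using G_mvt[of x h 1 k] assms by (auto simp: in_V)
  have "\<bar>(G (x + h) - G x - H x h) \<bullet> k\<bar> = \<bar>(H (x + \<xi> *\<^sub>R h) h - H x h) \<bullet> k\<bar>"
    using \<xi> by (simp add: inner_diff_left)
  also have "\<dots> \<le> norm (H (x + \<xi> *\<^sub>R h) h - H x h) * norm k"
    by (rule Cauchy_Schwarz_ineq2)
  also have "\<dots> \<le> (L * norm (x + \<xi> *\<^sub>R h - x) * norm h) * norm k"
    using assms by (intro mult_right_mono H_lipschitz) (auto simp: in_V)
  also have "\<dots> = L * (\<xi> * norm h) * norm h * norm k"
    using \<open>0 < \<xi>\<close> by simp
  also have "\<dots> \<le> L * (1 * norm h) * norm h * norm k"
    using \<open>\<xi> < 1\<close> L by (intro mult_right_mono mult_left_mono) auto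
  finally show ?thesis
    by (simp add: power2_eq_square)
qed

section \<open>Symmetry of the Hessian\<close>

text \<open>The mean value theorem is applied to \<open>f\<close> in direction \<open>u\<close> and
  then to \<open>G\<close> in direction \<open>v\<close>. This leaves the Hessian at a point within
  \<open>b * (norm u + norm v)\<close> of \<open>x\<close>.\<close>

lemma double_difference:
  assumes x: "x \<in> V" and u: "u \<in> V" and v: "v \<in> V" and b: "0 < b"
  shows "\<bar>(f (x + b *\<^sub>R u + b *\<^sub>R v) - f (x + b *\<^sub>R u) - f (x + b *\<^sub>R v) + f x) - b\<^sup>2 * (H x v \<bullet> u)\<bar>
    \<le> b ^ 3 * (L * (norm u + norm v) * norm v * norm u)"
proof -
  \<comment> \<open>The increment of \<open>?g\<close> over \<open>[0, b]\<close> is the whole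
    second difference.\<close>
  let ?g = "\<lambda>s. f ((x + b *\<^sub>R v) + s *\<^sub>R u) - f (x + s *\<^sub>R u)"
  have "(?g has_real_derivative G ((x + b *\<^sub>R v) + s *\<^sub>R u) \<bullet> u - G (x + s *\<^sub>R u) \<bullet> u) (at s)" for s
    using f_line[of "x + b *\<^sub>R v" u s] f_line[of x u s] x u v by (auto intro!: DERIV_diff simp: in_V)
  from MVT2[OF b this]
  obtain \<xi> where \<xi>: "0 < \<xi>" "\<xi> < b"
    "?g b - ?g 0 = (b - 0) * (G ((x + b *\<^sub>R v) + \<xi> *\<^sub>R u) \<bullet> u - G (x + \<xi> *\<^sub>R u) \<bullet> u)"
    by blast
  obtain \<eta> where \<eta>: "0 < \<eta>" "\<eta> < b"
    "(G ((x + \<xi> *\<^sub>R u) + b *\<^sub>R v) - G (x + \<xi> *\<^sub>R u)) \<bullet> u = b * (H ((x + \<xi> *\<^sub>R u) + \<eta> *\<^sub>R v) v \<bullet> u)"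
    using G_mvt[of "x + \<xi> *\<^sub>R u" v b u] x u v b by (auto simp: in_V)
  let ?y = "x + \<xi> *\<^sub>R u + \<eta> *\<^sub>R v"
  have "?g b - ?g 0 = b\<^sup>2 * (H ?y v \<bullet> u)"
    using \<xi>(3) \<eta>(3) by (simp add: inner_diff_left power2_eq_square algebra_simps)
  then have "(f (x + b *\<^sub>R u + b *\<^sub>R v) - f (x + b *\<^sub>R u) - f (x + b *\<^sub>R v) + f x) - b\<^sup>2 * (H x v \<bullet> u)
      = b\<^sup>2 * ((H ?y v - H x v) \<bullet> u)"
    by (simp add: algebra_simps inner_diff_left)
  then have "\<bar>(f (x + b *\<^sub>R u + b *\<^sub>R v) - f (x + b *\<^sub>R u) - f (x + b *\<^sub>R v) + f x) - b\<^sup>2 * (H x v \<bullet> u)\<bar>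
      = b\<^sup>2 * \<bar>(H ?y v - H x v) \<bullet> u\<bar>"
    by (simp add: abs_mult)
  also have "\<bar>(H ?y v - H x v) \<bullet> u\<bar> \<le> norm (H ?y v - H x v) * norm u"
    by (rule Cauchy_Schwarz_ineq2)
  also have "\<dots> \<le> (L * norm (?y - x) * norm v) * norm u"
    using x u v by (intro mult_right_mono H_lipschitz) (auto simp: in_V)
  also have "norm (?y - x) \<le> b * (norm u + norm v)"
  proof -
    have "norm (?y - x) \<le> norm (\<xi> *\<^sub>R u) + norm (\<eta> *\<^sub>R v)"
      using norm_triangle_ineq[of "\<xi> *\<^sub>R u" "\<eta> *\<^sub>R v"] by (simp add: add.assoc)
    also have "\<dots> \<le> b * norm u + b * norm v"
      using \<xi> \<eta> by (auto intro!: add_mono mult_right_mono)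
    finally show ?thesis by (simp add: algebra_simps)
  qed
  finally show ?thesis
    using L b by (simp add: mult_left_mono mult_right_mono power3_eq_cube power2_eq_square mult_ac)
qed

text \<open>The second difference is unchanged when \<open>u\<close> and \<open>v\<close> are
  interchanged, so both pairings approximate the same number with an error of third order; division
  by the square of the step leaves an arbitrarily small error.\<close>

lemma H_symmetric:
  assumes x: "x \<in> V" and u: "u \<in> V" and v: "v \<in> V"
  shows "H x u \<bullet> v = H x v \<bullet> u"
proof -
  let ?K = "L * (norm u + norm v) * norm v * norm u"
  have "\<bar>H x u \<bullet> v - H x v \<bullet> u\<bar> \<le> 0 + b" if b: "0 < b" for b
  proof -
    \<comment> \<open>Chosen so that \<open>c * (2 * ?K + 1) = b\<close>; the summand 1 keeps the
      denominator positive when \<open>?K = 0\<close>.\<close>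
    define c where "c = b / (2 * ?K + 1)"
    have K: "0 \<le> ?K" using L by simp
    have c: "0 < c" using b K by (simp add: c_def)
    let ?Q = "f (x + c *\<^sub>R u + c *\<^sub>R v) - f (x + c *\<^sub>R u) - f (x + c *\<^sub>R v) + f x"
    have "\<bar>?Q - c\<^sup>2 * (H x v \<bullet> u)\<bar> \<le> c ^ 3 * ?K"
      by (rule double_difference[OF x u v c])
    moreover have "\<bar>?Q - c\<^sup>2 * (H x u \<bullet> v)\<bar> \<le> c ^ 3 * ?K"
      using double_difference[OF x v u c] by (simp add: algebra_simps)
    ultimately have "\<bar>c\<^sup>2 * (H x u \<bullet> v) - c\<^sup>2 * (H x v \<bullet> u)\<bar> \<le> 2 * (c ^ 3 * ?K)"
      by linarith
    then have "c\<^sup>2 * \<bar>H x u \<bullet> v - H x v \<bullet> u\<bar> \<le> c\<^sup>2 * (c * (2 * ?K))"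
      by (simp add: right_diff_distrib[symmetric] abs_mult power3_eq_cube power2_eq_square mult_ac)
    then have "\<bar>H x u \<bullet> v - H x v \<bullet> u\<bar> \<le> c * (2 * ?K)"
      using c by simp
    also have "\<dots> \<le> c * (2 * ?K + 1)"
      using c by simp
    also have "\<dots> = b"
      using K by (simp add: c_def)
    finally show ?thesis by simp
  qed
  then have "\<bar>H x u \<bullet> v - H x v \<bullet> u\<bar> \<le> 0"
    by (rule field_le_epsilon)
  then show ?thesis by simp
qed

text \<open>Up to Taylor remainders the pairings are \<open>H x h \<bullet> (y - x)\<close> and
  \<open>H x (y - x) \<bullet> h\<close>, which agree by symmetry of the Hessian. An increment of
  the gradient can thus be traded for an increment of the state.\<close>

lemma G_increment:
  assumes x: "x \<in> V" and y: "y \<in> V" and h: "h \<in> V"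
  shows "\<bar>(G (x + h) - G x) \<bullet> (y - x) - (G y - G x) \<bullet> h\<bar>
    \<le> L * (norm (y - x))\<^sup>2 * norm h + L * norm (y - x) * (norm h)\<^sup>2"
proof -
  have "H x h \<bullet> (y - x) = H x (y - x) \<bullet> h"
    using x y h by (intro H_symmetric) (auto simp: in_V)
  moreover have "\<bar>(G (x + h) - G x - H x h) \<bullet> (y - x)\<bar> \<le> L * (norm h)\<^sup>2 * norm (y - x)"
    by (rule G_taylor[OF x h])
  moreover have "\<bar>(G y - G x - H x (y - x)) \<bullet> h\<bar> \<le> L * (norm (y - x))\<^sup>2 * norm h"
    using G_taylor[of x "y - x" h] x y by (simp add: in_V)
  ultimately show ?thesis
    by (simp add: inner_diff_left abs_le_iff algebra_simps)
qed

section \<open>Strong convexity and affine minorants\<close>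

text \<open>Subtracting the linear and the quadratic term along the segment leaves a function with
  nonnegative derivative, by the mean value identity for \<open>G\<close>.\<close>

lemma strongly_convex_if_hessian_ge:
  assumes x: "x \<in> V" and h: "h \<in> V" and c: "\<And>z. z \<in> V \<Longrightarrow> c * (norm h)\<^sup>2 \<le> H z h \<bullet> h"
  shows "f x + G x \<bullet> h + c / 2 * (norm h)\<^sup>2 \<le> f (x + h)"
proof -
  define \<phi> where "\<phi> s = f (x + s *\<^sub>R h) - s * (G x \<bullet> h) - s\<^sup>2 * (c / 2 * (norm h)\<^sup>2)" for s
  have deriv: "(\<phi> has_real_derivative G (x + s *\<^sub>R h) \<bullet> h - 1 * (G x \<bullet> h) - 2 * s * (c / 2 * (norm h)\<^sup>2)) (at s)" for s
    unfolding \<phi>_def[abs_def]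
    by (intro DERIV_diff f_line x h DERIV_cmult_right) (auto intro!: derivative_eq_intros)
  have nonneg: "0 \<le> G (x + s *\<^sub>R h) \<bullet> h - 1 * (G x \<bullet> h) - 2 * s * (c / 2 * (norm h)\<^sup>2)" if "0 \<le> s" for s
  proof (cases "s = 0")
    case False
    with that have "0 < s"
      by simp
    from G_mvt[OF x h this, of h]
    obtain \<xi> where "(G (x + s *\<^sub>R h) - G x) \<bullet> h = s * (H (x + \<xi> *\<^sub>R h) h \<bullet> h)"
      by blast
    moreover have "s * (c * (norm h)\<^sup>2) \<le> s * (H (x + \<xi> *\<^sub>R h) h \<bullet> h)"
      using that x h by (intro mult_left_mono c) (auto simp: in_V)
    ultimately show ?thesis
      by (simp add: inner_diff_left)
  qed simp
  have "\<phi> 0 \<le> \<phi> 1"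
    by (rule DERIV_nonneg_imp_nondecreasing[of 0 1 \<phi>]) (simp, use deriv nonneg in blast)
  then show ?thesis
    by (simp add: \<phi>_def)
qed

text \<open>The difference between \<open>f\<close> and the affine minorant is minimal at
  \<open>s = 0\<close>, so its derivative vanishes there.\<close>

lemma gradient_eq_if_minorant:
  assumes x: "x \<in> V" and h: "h \<in> V"
    and le: "\<And>s. f x + s * p \<le> f (x + s *\<^sub>R h)"
  shows "G x \<bullet> h = p"
proof -
  have "((\<lambda>s. f (x + s *\<^sub>R h) - s * p) has_real_derivative G (x + 0 *\<^sub>R h) \<bullet> h - 1 * p) (at 0)"
    by (intro DERIV_diff f_line x h DERIV_cmult_right DERIV_ident)
  then have "G (x + 0 *\<^sub>R h) \<bullet> h - 1 * p = 0"
    by (rule DERIV_local_min[where d = 1]) (use le in \<open>auto simp: algebra_simps\<close>)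
  then show ?thesis by simp
qed

end

section \<open>Functions with quadratic increments\<close>

text \<open>Splitting where \<open>P\<close> has made half of its increment gives two bounds with a
  quarter of the square each, so every splitting halves the total; iteration drives it to
  zero.\<close>

lemma antimono_if_increments_quadratic:
  fixes \<Phi> P :: "real \<Rightarrow> real"
  assumes "a \<le> b" and cont: "continuous_on {a..b} P"
    and mono: "\<And>s t. \<lbrakk>a \<le> s; s \<le> t; t \<le> b\<rbrakk> \<Longrightarrow> P s \<le> P t"
    and le: "\<And>s t. \<lbrakk>a \<le> s; s \<le> t; t \<le> b\<rbrakk> \<Longrightarrow> \<Phi> t - \<Phi> s \<le> K * (P t - P s)\<^sup>2"
  shows "\<Phi> b \<le> \<Phi> a"
proof -
  have halving: "\<Phi> t - \<Phi> s \<le> K * (P t - P s)\<^sup>2 / 2 ^ n" if "a \<le> s" "s \<le> t" "t \<le> b" for n s t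
    using that
  proof (induction n arbitrary: s t)
    case 0
    then show ?case using le by simp
  next
    case (Suc n)
    have "continuous_on {s..t} P"
      using cont by (rule continuous_on_subset) (use Suc in auto)
    moreover have "P s \<le> P t"
      using mono Suc.prems by simp
    \<comment> \<open>The midpoint is taken in the values of \<open>P\<close>, not in time, so
      continuity of \<open>P\<close> suffices.\<close>
    ultimately obtain m where m: "P m = (P s + P t) / 2" and sm: "s \<le> m" "m \<le> t"
      using IVT'[of P s "(P s + P t) / 2" t] Suc.prems by auto
    have "\<Phi> t - \<Phi> m \<le> K * ((P t - P s) / 2)\<^sup>2 / 2 ^ n"
      using Suc.IH[of m t] Suc.prems sm m by (simp add: field_simps)
    moreover have "\<Phi> m - \<Phi> s \<le> K * ((P t - P s) / 2)\<^sup>2 / 2 ^ n"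
      using Suc.IH[of s m] Suc.prems sm m by (simp add: field_simps)
    ultimately have "\<Phi> t - \<Phi> s \<le> 2 * (K * ((P t - P s) / 2)\<^sup>2 / 2 ^ n)"
      by linarith
    also have "\<dots> = K * (P t - P s)\<^sup>2 / 2 ^ Suc n"
      by (simp add: power_divide)
    finally show ?case .
  qed
  have "(\<lambda>n. K * (P b - P a)\<^sup>2 / 2 ^ n) \<longlonglongrightarrow> 0"
    by (rule LIMSEQ_divide_realpow_zero) simp
  then have "\<Phi> b - \<Phi> a \<le> 0"
    by (rule Lim_bounded2) (use halving[of a b] \<open>a \<le> b\<close> in auto)
  then show ?thesis by simp
qed

section \<open>Weak derivatives in one dimension\<close>

text \<open>The test functions for the fundamental theorem are ramps with slope given by tents of width
  \<open>h\<close>, written as second difference quotients of \<open>x \<mapsto> (max 0 x)\<^sup>2 / 2\<close>.\<close>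

definition tent :: "real \<Rightarrow> real \<Rightarrow> real"
  where "tent h x = (max 0 (x + h) - 2 * max 0 x + max 0 (x - h)) / h\<^sup>2"

definition ramp :: "real \<Rightarrow> real \<Rightarrow> real"
  where "ramp h x = ((max 0 (x + h))\<^sup>2 - 2 * (max 0 x)\<^sup>2 + (max 0 (x - h))\<^sup>2) / (2 * h\<^sup>2)"

lemma has_real_derivative_max_0_square:
  "((\<lambda>x::real. (max 0 x)\<^sup>2) has_real_derivative 2 * max 0 x) (at x)"
proof (cases "x = 0")
  case True
  have "((\<lambda>x::real. (max 0 x)\<^sup>2 / x) \<longlongrightarrow> 0) (at 0)"
  proof (rule Lim_null_comparison)
    show "\<forall>\<^sub>F x in at 0. norm ((max 0 x)\<^sup>2 / x :: real) \<le> \<bar>x\<bar>"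
      by (rule always_eventually) (auto simp: max_def power2_eq_square)
    show "((\<lambda>x::real. \<bar>x\<bar>) \<longlongrightarrow> 0) (at 0)"
      by (rule tendsto_rabs_zero) simp
  qed
  then show ?thesis
    using True by (simp add: has_field_derivative_iff)
next
  case False
  show ?thesis
  proof (cases "0 < x")
    case True
    have "((\<lambda>x::real. x\<^sup>2) has_real_derivative 2 * max 0 x) (at x)"
      using True by (auto intro!: derivative_eq_intros)
    then show ?thesis
      by (rule has_field_derivative_transform_within_open[of _ _ _ "{0<..}"]) (use True in auto)
  next
    case neg: False
    have "((\<lambda>x::real. 0) has_real_derivative 2 * max 0 x) (at x)"
      using neg by simp
    then show ?thesis
      by (rule has_field_derivative_transform_within_open[of _ _ _ "{..<0}"]) (use neg False in auto)
  qed
qed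

lemma ramp_has_derivative: "(ramp h has_real_derivative tent h x) (at x)"
proof -
  have shift: "((\<lambda>x. (max 0 (x + d))\<^sup>2) has_real_derivative 2 * max 0 (x + d)) (at x)" for d :: real
    using DERIV_shift[of "\<lambda>x. (max 0 x)\<^sup>2" "2 * max 0 (x + d)" x d] has_real_derivative_max_0_square
    by simp
  \<comment> \<open>Writing \<open>x + 0\<close> and \<open>x + - h\<close> gives all three terms
    the form covered by \<open>shift\<close>.\<close>
  have "((\<lambda>x. ((max 0 (x + h))\<^sup>2 - 2 * (max 0 (x + 0))\<^sup>2 + (max 0 (x + - h))\<^sup>2) / (2 * h\<^sup>2))
      has_real_derivative (2 * max 0 (x + h) - 2 * (2 * max 0 (x + 0)) + 2 * max 0 (x + - h)) / (2 * h\<^sup>2)) (at x)"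
    by (intro DERIV_cdivide DERIV_add DERIV_diff DERIV_cmult shift)
  moreover have "(2 * max 0 (x + h) - 2 * (2 * max 0 (x + 0)) + 2 * max 0 (x + - h)) / (2 * h\<^sup>2) = tent h x"
    by (simp add: tent_def add_divide_distrib diff_divide_distrib)
  ultimately show ?thesis
    by (simp add: ramp_def[abs_def])
qed

lemma continuous_on_tent: "continuous_on A (tent h)"
  unfolding tent_def[abs_def] divide_inverse by (intro continuous_intros)

lemma tent_nonneg: "0 < h \<Longrightarrow> 0 \<le> tent h x"
  by (auto simp: tent_def max_def)

lemma tent_eq_0: "0 < h \<Longrightarrow> h \<le> \<bar>x\<bar> \<Longrightarrow> tent h x = 0"
  by (auto simp: tent_def max_def)

lemma ramp_eq_0: "0 < h \<Longrightarrow> x \<le> - h \<Longrightarrow> ramp h x = 0"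
  by (auto simp: ramp_def max_def)

lemma ramp_eq_1: "0 < h \<Longrightarrow> h \<le> x \<Longrightarrow> ramp h x = 1"
proof -
  assume "0 < h" "h \<le> x"
  then have "ramp h x = ((x + h)\<^sup>2 - 2 * x\<^sup>2 + (x - h)\<^sup>2) / (2 * h\<^sup>2)"
    by (simp add: ramp_def)
  also have "(x + h)\<^sup>2 - 2 * x\<^sup>2 + (x - h)\<^sup>2 = 2 * h\<^sup>2"
    by (simp add: power2_sum power2_diff)
  finally show "ramp h x = 1"
    using \<open>0 < h\<close> by simp
qed

lemma ramp_mono: "0 < h \<Longrightarrow> x \<le> y \<Longrightarrow> ramp h x \<le> ramp h y"
  by (rule DERIV_nonneg_imp_nondecreasing) (use ramp_has_derivative tent_nonneg in blast)+

lemma ramp_bounds: "0 < h \<Longrightarrow> 0 \<le> ramp h x \<and> ramp h x \<le> 1"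
  using ramp_mono[of h "min x (- h)" x] ramp_mono[of h x "max x h"] ramp_eq_0[of h "min x (- h)"] ramp_eq_1[of h "max x h"]
  by simp

lemma ramp_0: "0 < h \<Longrightarrow> ramp h 0 = 1 / 2"
  by (simp add: ramp_def)

section \<open>Increments of functions with a weak derivative\<close>

text \<open>The tents are an approximate identity: eventually they have mass one on the interval,
  and they vanish outside a neighbourhood of \<open>a\<close> on which \<open>u\<close> is close to
  \<open>u a\<close>.\<close>

lemma tendsto_integral_tent:
  fixes u :: "real \<Rightarrow> 'a::euclidean_space"
  assumes u: "continuous_on {0..T} u" and a: "0 < a" "a < T"
    and h: "\<And>n. 0 < h n" "h \<longlonglongrightarrow> 0"
  shows "(\<lambda>n. integral {0..T} (\<lambda>s. tent (h n) (s - a) *\<^sub>R u s)) \<longlonglongrightarrow> u a"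
proof (rule LIMSEQ_I)
  fix r :: real assume "0 < r"
  have "continuous_on {0..T} u" "a \<in> {0..T}" using assms by auto
  then obtain d where d: "0 < d" "\<And>s. \<lbrakk>s \<in> {0..T}; dist s a < d\<rbrakk> \<Longrightarrow> dist (u s) (u a) < r / 2"
    unfolding continuous_on_iff using \<open>0 < r\<close> by (meson half_gt_zero)
  \<comment> \<open>A width below \<open>d\<close> restricts the tent to values of \<open>u\<close>
    close to \<open>u a\<close>; a width below \<open>a\<close> and \<open>T - a\<close> keeps its
    support inside the interval, so that its mass is exactly one.\<close>
  have "0 < min d (min a (T - a))"
    using d a by simp
  then have "\<forall>\<^sub>F n in sequentially. h n < min d (min a (T - a))"
    using h(2) order_tendstoD(2) by blast
  then obtain N where N: "\<And>n. N \<le> n \<Longrightarrow> h n < min d (min a (T - a))"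
    unfolding eventually_sequentially by blast
  have "norm (integral {0..T} (\<lambda>s. tent (h n) (s - a) *\<^sub>R u s) - u a) < r" if "N \<le> n" for n
  proof -
    let ?k = "\<lambda>s. tent (h n) (s - a)"
    have cont: "continuous_on {0..T} ?k"
      by (rule continuous_on_compose2[OF continuous_on_tent]) (auto intro!: continuous_intros)
    have "((\<lambda>s. ramp (h n) (s - a)) has_real_derivative ?k s) (at s within {0..T})" for s
      using DERIV_shift[of "ramp (h n)" "?k s" s "- a"] ramp_has_derivative
      by (auto intro: has_field_derivative_at_within)
    then have "(?k has_integral ramp (h n) (T - a) - ramp (h n) (0 - a)) {0..T}"
      using a by (intro fundamental_theorem_of_calculus)
        (auto simp: has_real_derivative_iff_has_vector_derivative[symmetric])
    then have k1: "(?k has_integral 1) {0..T}"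
      using N[OF that] h(1)[of n] by (simp add: ramp_eq_0 ramp_eq_1)
    have int: "(\<lambda>s. ?k s *\<^sub>R u s) integrable_on {0..T}"
      using u cont by (intro integrable_continuous_real continuous_intros)
    have int': "((\<lambda>s. ?k s *\<^sub>R u a) has_integral u a) {0..T}"
      using has_integral_scaleR_left[OF k1, of "u a"] by simp
    have "norm (integral {0..T} (\<lambda>s. ?k s *\<^sub>R u s - ?k s *\<^sub>R u a)) \<le> integral {0..T} (\<lambda>s. ?k s * (r / 2))"
    proof (rule integral_norm_bound_integral)
      show "(\<lambda>s. ?k s *\<^sub>R u s - ?k s *\<^sub>R u a) integrable_on {0..T}"
        using int int' by (intro integrable_diff) auto
      show "(\<lambda>s. ?k s * (r / 2)) integrable_on {0..T}"
        using has_integral_mult_left[OF k1] by blast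
      fix s assume s: "s \<in> {0..T}"
      show "norm (?k s *\<^sub>R u s - ?k s *\<^sub>R u a) \<le> ?k s * (r / 2)"
      proof (cases "\<bar>s - a\<bar> < h n")
        case True
        then have "dist (u s) (u a) < r / 2"
          using N[OF that] s d(2)[of s] by (simp add: dist_real_def)
        then show ?thesis
          using tent_nonneg[OF h(1)] mult_left_mono[of "norm (u s - u a)" "r / 2" "?k s"]
          by (simp add: scaleR_diff_right[symmetric] dist_norm)
      next
        case False
        then show ?thesis
          using tent_eq_0[OF h(1)[of n], of "s - a"] by simp
      qed
    qed
    also have "\<dots> = r / 2"
      using has_integral_mult_left[OF k1, of "r / 2"] by (rule integral_unique[THEN trans]) simp
    also have "integral {0..T} (\<lambda>s. ?k s *\<^sub>R u s - ?k s *\<^sub>R u a) = integral {0..T} (\<lambda>s. ?k s *\<^sub>R u s) - u a"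
      using int int' by (subst integral_diff) (auto simp: integral_unique)
    finally show ?thesis
      using \<open>0 < r\<close> by simp
  qed
  then show "\<exists>N. \<forall>n\<ge>N. norm (integral {0..T} (\<lambda>s. tent (h n) (s - a) *\<^sub>R u s) - u a) < r"
    by blast
qed

text \<open>The difference of the ramps at \<open>a\<close> and \<open>b\<close> is a test function
  that tends to the indicator of \<open>[a, b]\<close>, while its derivative, a difference of tents,
  concentrates at the end points. Dominated convergence passes to the limit in the weak
  formulation.\<close>

lemma weak_derivative_increment_interior:
  fixes u g :: "real \<Rightarrow> 'a::euclidean_space"
  assumes u: "continuous_on {0..T} u" and g: "g absolutely_integrable_on {0..T}"
    and weak: "weak_derivative T u g" and ab: "0 < a" "a \<le> b" "b < T"
  shows "u b - u a = integral {a..b} g"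
proof -
  \<comment> \<open>Denominators starting at 2 keep the supports, which reach \<open>h n\<close>
    beyond \<open>a\<close> and \<open>b\<close>, inside the open interval already for
    \<open>n = 0\<close>.\<close>
  define h where "h n = min a (T - b) / (2 + real n)" for n
  have h: "0 < h n" for n
    using ab by (simp add: h_def)
  have h0: "h \<longlonglongrightarrow> 0"
    unfolding h_def by (rule real_tendsto_divide_at_top[OF tendsto_const])
      (rule filterlim_tendsto_add_at_top[OF tendsto_const filterlim_real_sequentially])
  have h_less: "h n < a" "h n < T - b" for n
  proof -
    have "h n \<le> min a (T - b) / 2"
      using ab unfolding h_def by (intro divide_left_mono) auto
    then show "h n < a" "h n < T - b"
      using ab by auto
  qed
  define \<phi> where "\<phi> n s = ramp (h n) (s - a) - ramp (h n) (s - b)" for n s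
  define \<phi>' where "\<phi>' n s = tent (h n) (s - a) - tent (h n) (s - b)" for n s
  have d: "(\<phi> n has_real_derivative \<phi>' n s) (at s)" for n s
  proof -
    have "((\<lambda>s. ramp (h n) (s - c)) has_real_derivative tent (h n) (s - c)) (at s)" for c
      using DERIV_shift[of "ramp (h n)" "tent (h n) (s - c)" s "- c"] ramp_has_derivative by auto
    then show ?thesis
      unfolding \<phi>_def[abs_def] \<phi>'_def by (intro DERIV_diff)
  qed
  have tent_cont: "continuous_on A (\<lambda>s. tent (h n) (s - c))" for n A c
    by (rule continuous_on_compose2[OF continuous_on_tent]) (auto intro!: continuous_intros)
  have test: "test_function T (\<phi> n) (\<phi>' n)" for n
    unfolding test_function_def
  proof (intro conjI allI)
    show "(\<phi> n has_real_derivative \<phi>' n s) (at s)" for s by (rule d)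
    show "continuous_on UNIV (\<phi>' n)"
      unfolding \<phi>'_def[abs_def] by (intro continuous_intros tent_cont)
    have "compact {a - h n..b + h n}" "{a - h n..b + h n} \<subseteq> {0<..<T}"
      using h_less[of n] by auto
    moreover have "\<phi> n s = 0" if "s \<notin> {a - h n..b + h n}" for s
      using that ab h[of n] by (auto simp: \<phi>_def ramp_eq_0 ramp_eq_1)
    ultimately show "\<exists>K. compact K \<and> K \<subseteq> {0<..<T} \<and> (\<forall>s. s \<notin> K \<longrightarrow> \<phi> n s = 0)"
      by blast
  qed
  have lim_u: "(\<lambda>n. integral {0..T} (\<lambda>s. \<phi>' n s *\<^sub>R u s)) \<longlonglongrightarrow> u a - u b"
  proof -
    have "integral {0..T} (\<lambda>s. \<phi>' n s *\<^sub>R u s)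
        = integral {0..T} (\<lambda>s. tent (h n) (s - a) *\<^sub>R u s) - integral {0..T} (\<lambda>s. tent (h n) (s - b) *\<^sub>R u s)" for n
      unfolding \<phi>'_def scaleR_diff_left
      by (intro integral_diff integrable_continuous_real continuous_intros tent_cont u)
    then show ?thesis
      using tendsto_diff[OF tendsto_integral_tent[OF u _ _ h h0, of a] tendsto_integral_tent[OF u _ _ h h0, of b]] ab
      by simp
  qed
  \<comment> \<open>The pointwise limit of the ramps. Its value at the jump matters only at
    \<open>a\<close> and \<open>b\<close>, a null set.\<close>
  define \<theta> :: "real \<Rightarrow> real" where "\<theta> x = (if x < 0 then 0 else if x = 0 then 1 / 2 else 1)" for x
  have lim_ramp: "(\<lambda>n. ramp (h n) x) \<longlonglongrightarrow> \<theta> x" for x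
  proof (cases "x = 0")
    case True
    then show ?thesis using h by (simp add: ramp_0 \<theta>_def)
  next
    case False
    then have "\<forall>\<^sub>F n in sequentially. h n < \<bar>x\<bar>"
      using order_tendstoD(2)[OF h0] by simp
    then have "\<forall>\<^sub>F n in sequentially. ramp (h n) x = \<theta> x"
      by eventually_elim (use False h in \<open>auto simp: \<theta>_def ramp_eq_0 ramp_eq_1\<close>)
    then show ?thesis
      by (rule tendsto_eventually)
  qed
  have lim_g: "(\<lambda>n. integral {0..T} (\<lambda>s. \<phi> n s *\<^sub>R g s)) \<longlonglongrightarrow> integral {0..T} (\<lambda>s. (\<theta> (s - a) - \<theta> (s - b)) *\<^sub>R g s)"
  proof (rule dominated_convergence(2))
    show "(\<lambda>s. norm (g s)) integrable_on {0..T}"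
      using g absolutely_integrable_on_def by blast
    fix n
    have cont: "continuous_on {0..T} (\<phi> n)"
      using d by (meson DERIV_continuous_on has_field_derivative_at_within)
    have "(\<lambda>s. \<phi> n s *\<^sub>R g s) absolutely_integrable_on {0..T}"
    proof (rule absolutely_integrable_bounded_measurable_product[where h = scaleR and f = "\<phi> n", OF _ _ _ _ g])
      show "bilinear (scaleR :: real \<Rightarrow> 'a \<Rightarrow> 'a)"
        using bilinear_conv_bounded_bilinear bounded_bilinear_scaleR by blast
      show "\<phi> n \<in> borel_measurable (lebesgue_on {0..T})"
        using cont by (rule continuous_imp_measurable_on_sets_lebesgue) auto
      show "bounded (\<phi> n ` {0..T})"
        using cont by (intro compact_imp_bounded compact_continuous_image) auto
    qed auto
    then show "(\<lambda>s. \<phi> n s *\<^sub>R g s) integrable_on {0..T}"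
      using absolutely_integrable_on_def by blast
    fix s
    have "\<bar>\<phi> n s\<bar> \<le> 1"
      using ramp_bounds[OF h[of n], of "s - a"] ramp_bounds[OF h[of n], of "s - b"] by (auto simp: \<phi>_def)
    then show "norm (\<phi> n s *\<^sub>R g s) \<le> norm (g s)"
      by (simp add: mult_left_le_one_le)
    show "(\<lambda>n. \<phi> n s *\<^sub>R g s) \<longlonglongrightarrow> (\<theta> (s - a) - \<theta> (s - b)) *\<^sub>R g s"
      unfolding \<phi>_def by (intro tendsto_intros lim_ramp)
  qed
  have "integral {0..T} (\<lambda>s. (\<theta> (s - a) - \<theta> (s - b)) *\<^sub>R g s)
      = integral {0..T} (\<lambda>s. if s \<in> {a..b} then g s else 0)"
    by (rule integral_spike[of "{a, b}"]) (use ab in \<open>auto simp: \<theta>_def\<close>)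
  also have "\<dots> = integral {a..b} g"
    using ab by (subst integral_restrict_Int) (simp add: min_def)
  finally have "(\<lambda>n. - integral {0..T} (\<lambda>s. \<phi> n s *\<^sub>R g s)) \<longlonglongrightarrow> - integral {a..b} g"
    using tendsto_minus[OF lim_g] by simp
  moreover have "- integral {0..T} (\<lambda>s. \<phi> n s *\<^sub>R g s) = integral {0..T} (\<lambda>s. \<phi>' n s *\<^sub>R u s)" for n
    using weak test[of n] by (simp add: weak_derivative_def)
  ultimately have "(\<lambda>n. integral {0..T} (\<lambda>s. \<phi>' n s *\<^sub>R u s)) \<longlonglongrightarrow> - integral {a..b} g"
    by simp
  from LIMSEQ_unique[OF lim_u this] have "u a - u b = - integral {a..b} g" .
  then show ?thesis
    by (simp add: algebra_simps)
qed

text \<open>By the interior case, \<open>u\<close> minus the primitive of \<open>g\<close> is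
  constant on the open interval; continuity extends this to the end points.\<close>

lemma weak_derivative_increment:
  fixes u g :: "real \<Rightarrow> 'a::euclidean_space"
  assumes u: "continuous_on {0..T} u" and g: "g absolutely_integrable_on {0..T}"
    and weak: "weak_derivative T u g" and "0 < T" and ab: "0 \<le> a" "a \<le> b" "b \<le> T"
  shows "u b - u a = integral {a..b} g"
proof -
  have gi: "g integrable_on {0..T}"
    using g absolutely_integrable_on_def by blast
  have split: "integral {0..s} g + integral {s..t} g = integral {0..t} g" if "0 \<le> s" "s \<le> t" "t \<le> T" for s t
    by (rule Henstock_Kurzweil_Integration.integral_combine[OF that(1,2)])
      (use that in \<open>auto intro: integrable_on_subinterval[OF gi]\<close>)
  define w where "w t = u t - integral {0..t} g" for t
  have w: "continuous_on {0..T} w"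
    unfolding w_def using u indefinite_integral_continuous_1[OF gi] by (rule continuous_on_diff)
  have interior: "w t = w (T / 2)" if "0 < t" "t < T" for t
  proof (cases "t \<le> T / 2")
    case True
    then show ?thesis
      using weak_derivative_increment_interior[OF u g weak, of t "T / 2"] that split[of t "T / 2"]
      by (simp add: w_def algebra_simps)
  next
    case False
    then show ?thesis
      using weak_derivative_increment_interior[OF u g weak, of "T / 2" t] that split[of "T / 2" t]
      by (simp add: w_def algebra_simps)
  qed
  have const: "w t = w (T / 2)" if "t \<in> {0..T}" for t
  proof (rule continuous_constant_on_closure[of "{0<..<T}" w])
    show "continuous_on (closure {0<..<T}) w" "t \<in> closure {0<..<T}"
      using w that \<open>0 < T\<close> by simp_all
    show "w s = w (T / 2)" if "s \<in> {0<..<T}" for s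
      using interior[of s] that by simp
  qed
  have "w a = w b"
    using const[of a] const[of b] ab by (metis atLeastAtMost_iff order_trans)
  then have "u b - u a = integral {0..b} g - integral {0..a} g"
    by (simp add: w_def algebra_simps)
  also have "\<dots> = integral {a..b} g"
    using split[OF ab] by (simp add: diff_eq_eq add.commute)
  finally show ?thesis .
qed

section \<open>Convex rate-independent evolutions\<close>

locale convex_evolution = smooth_on_subspace V f G H M L
  for V :: "'a::euclidean_space set" and f G H M L +
  fixes \<alpha> :: real and D :: "'a \<Rightarrow> real"
  assumes \<alpha>: "0 < \<alpha>"
    and strongly_convex: "\<lbrakk>x \<in> V; h \<in> V\<rbrakk> \<Longrightarrow> f x + G x \<bullet> h + \<alpha> / 2 * (norm h)\<^sup>2 \<le> f (x + h)"
    and D_scale: "\<lbrakk>h \<in> V; 0 < r\<rbrakk> \<Longrightarrow> D (r *\<^sub>R h) = r * D h"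
begin

text \<open>The energy balance enters as an inequality on every subinterval, with the dissipation of
  a single increment. No regularity of \<open>y\<close> is built in beyond integrability of
  \<open>l' \<bullet> y\<close>.\<close>

definition evolution :: "real \<Rightarrow> (real \<Rightarrow> 'a) \<Rightarrow> (real \<Rightarrow> 'a) \<Rightarrow> (real \<Rightarrow> 'a) \<Rightarrow> bool"
  where "evolution T l l' y \<longleftrightarrow>
    (\<forall>t\<in>{0..T}. y t \<in> V) \<and>
    l' absolutely_integrable_on {0..T} \<and> (\<lambda>s. l' s \<bullet> y s) absolutely_integrable_on {0..T} \<and>
    (\<forall>s t. 0 \<le> s \<longrightarrow> s \<le> t \<longrightarrow> t \<le> T \<longrightarrow> l t - l s = integral {s..t} l') \<and>
    (\<forall>t\<in>{0..T}. \<forall>h\<in>V. f (y t) - l t \<bullet> y t \<le> f (y t + h) - l t \<bullet> (y t + h) + D h) \<and>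
    (\<forall>s t. 0 \<le> s \<longrightarrow> s \<le> t \<longrightarrow> t \<le> T \<longrightarrow>
       f (y t) - l t \<bullet> y t + D (y t - y s) \<le> f (y s) - l s \<bullet> y s - integral {s..t} (\<lambda>r. l' r \<bullet> y r))"

lemma G_strongly_monotone:
  assumes "x \<in> V" "y \<in> V"
  shows "\<alpha> * (norm (x - y))\<^sup>2 \<le> (G x - G y) \<bullet> (x - y)"
  using strongly_convex[of x "y - x"] strongly_convex[of y "x - y"] assms
  by (simp add: in_V norm_minus_commute inner_diff_left inner_diff_right)

text \<open>Stability is tested with a small multiple \<open>r\<close> of \<open>h\<close>.
  Homogeneity of \<open>D\<close> lets \<open>r\<close> cancel, convexity bounds the energy
  difference by the gradient at the displaced point, and the Lipschitz bound moves that gradient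
  back to \<open>x\<close>.\<close>

lemma stable_force:
  assumes x: "x \<in> V" and h: "h \<in> V"
    and stable: "\<And>h. h \<in> V \<Longrightarrow> f x - b \<bullet> x \<le> f (x + h) - b \<bullet> (x + h) + D h"
  shows "(b - G x) \<bullet> h \<le> D h"
proof (rule field_le_epsilon)
  fix \<epsilon> :: real assume \<epsilon>: "0 < \<epsilon>"
  \<comment> \<open>Makes \<open>r * (M * (norm h)\<^sup>2 + 1) = \<epsilon>\<close>, which
    dominates the error of displacing the gradient.\<close>
  define r where "r = \<epsilon> / (M * (norm h)\<^sup>2 + 1)"
  have den: "0 < M * (norm h)\<^sup>2 + 1"
    using M by (simp add: add_nonneg_pos)
  then have r: "0 < r"
    using \<epsilon> by (simp add: r_def)
  have rh: "r *\<^sub>R h \<in> V" "x + r *\<^sub>R h \<in> V"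
    using x h by (auto simp: in_V)
  have "f (x + r *\<^sub>R h) - r * (G (x + r *\<^sub>R h) \<bullet> h) \<le> f x"
  proof -
    have nonneg: "0 \<le> \<alpha> / 2 * (norm (- (r *\<^sub>R h)))\<^sup>2"
      using \<alpha> by simp
    have le: "f (x + r *\<^sub>R h) + G (x + r *\<^sub>R h) \<bullet> (- (r *\<^sub>R h)) + \<alpha> / 2 * (norm (- (r *\<^sub>R h)))\<^sup>2
        \<le> f (x + r *\<^sub>R h + - (r *\<^sub>R h))"
      using rh by (intro strongly_convex) (auto simp: in_V)
    have "x + r *\<^sub>R h + - (r *\<^sub>R h) = x"
      by simp
    from le[unfolded this inner_minus_right inner_scaleR_right] nonneg
    show ?thesis by linarith
  qed
  moreover have "f x \<le> f (x + r *\<^sub>R h) - r * (b \<bullet> h) + r * D h"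
    using stable[OF rh(1)] D_scale[OF h r] by (simp add: inner_add_right)
  ultimately have "r * (b \<bullet> h) \<le> r * (D h + G (x + r *\<^sub>R h) \<bullet> h)"
    by (simp add: algebra_simps)
  then have "b \<bullet> h \<le> D h + G (x + r *\<^sub>R h) \<bullet> h"
    using r by simp
  moreover have "(G (x + r *\<^sub>R h) - G x) \<bullet> h \<le> \<epsilon>"
  proof -
    have "(G (x + r *\<^sub>R h) - G x) \<bullet> h \<le> norm (G (x + r *\<^sub>R h) - G x) * norm h"
      by (rule norm_cauchy_schwarz)
    also have "\<dots> \<le> M * norm (x + r *\<^sub>R h - x) * norm h"
      by (intro mult_right_mono G_lipschitz x rh) simp
    also have "\<dots> = r * (M * (norm h)\<^sup>2)"
      using r by (simp add: power2_eq_square)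
    also have "\<dots> \<le> r * (M * (norm h)\<^sup>2 + 1)"
      using r by simp
    also have "\<dots> = \<epsilon>"
      using den by (simp add: r_def)
    finally show ?thesis .
  qed
  ultimately show "(b - G x) \<bullet> h \<le> D h + \<epsilon>"
    by (simp add: inner_diff_left)
qed

section \<open>A priori estimates for one evolution\<close>

context
  fixes T l l' y
  assumes ev: "evolution T l l' y"
begin

lemma evolution_in_V: "t \<in> {0..T} \<Longrightarrow> y t \<in> V"
  using ev by (simp add: evolution_def)

lemma load_increment: "\<lbrakk>0 \<le> s; s \<le> t; t \<le> T\<rbrakk> \<Longrightarrow> l t - l s = integral {s..t} l'"
  using ev by (simp add: evolution_def)

lemma evolution_force: "\<lbrakk>t \<in> {0..T}; h \<in> V\<rbrakk> \<Longrightarrow> (l t - G (y t)) \<bullet> h \<le> D h"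
  using ev by (intro stable_force evolution_in_V) (auto simp: evolution_def)

lemma rate_integrable:
  assumes "0 \<le> s" "t \<le> T"
  shows "l' integrable_on {s..t}" "(\<lambda>r. norm (l' r)) integrable_on {s..t}"
    "(\<lambda>r. l' r \<bullet> y r) integrable_on {s..t}" "(\<lambda>r. \<bar>l' r \<bullet> y r\<bar>) integrable_on {s..t}"
    "(\<lambda>r. l' r \<bullet> x) integrable_on {s..t}"
proof -
  have sub: "{s..t} \<subseteq> {0..T}"
    using assms by auto
  have "l' absolutely_integrable_on {0..T}" "(\<lambda>r. l' r \<bullet> y r) absolutely_integrable_on {0..T}"
    using ev by (simp_all add: evolution_def)
  then have all: "l' integrable_on {0..T}" "(\<lambda>r. norm (l' r)) integrable_on {0..T}"
    "(\<lambda>r. l' r \<bullet> y r) integrable_on {0..T}" "(\<lambda>r. \<bar>l' r \<bullet> y r\<bar>) integrable_on {0..T}"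
    by (simp_all add: absolutely_integrable_on_def)
  show "l' integrable_on {s..t}" "(\<lambda>r. norm (l' r)) integrable_on {s..t}"
    "(\<lambda>r. l' r \<bullet> y r) integrable_on {s..t}" "(\<lambda>r. \<bar>l' r \<bullet> y r\<bar>) integrable_on {s..t}"
    using all by (auto intro: integrable_on_subinterval[OF _ sub])
  then show "(\<lambda>r. l' r \<bullet> x) integrable_on {s..t}"
    using integrable_linear[OF _ bounded_linear_inner_left, of l' "{s..t}" x] by (simp add: o_def)
qed

text \<open>Strong convexity at \<open>y s\<close> is inserted into the energy inequality. As
  \<open>l t - l s\<close> is the integral of \<open>l'\<close>, the load terms collect into the
  force at \<open>s\<close> and an integral that sees only increments of \<open>y\<close>.\<close>

lemma dissipation_increment:
  assumes st: "0 \<le> s" "s \<le> t" "t \<le> T"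
  shows "D (y t - y s) + \<alpha> / 2 * (norm (y t - y s))\<^sup>2
    \<le> (l s - G (y s)) \<bullet> (y t - y s) + integral {s..t} (\<lambda>r. l' r \<bullet> (y t - y r))"
proof -
  have yV: "y s \<in> V" "y t \<in> V"
    using st by (auto intro: evolution_in_V)
  have "f (y s) + G (y s) \<bullet> (y t - y s) + \<alpha> / 2 * (norm (y t - y s))\<^sup>2 \<le> f (y t)"
    using strongly_convex[of "y s" "y t - y s"] yV by (simp add: in_V)
  moreover have "f (y t) - l t \<bullet> y t + D (y t - y s) \<le> f (y s) - l s \<bullet> y s - integral {s..t} (\<lambda>r. l' r \<bullet> y r)"
    using ev st by (simp add: evolution_def)
  moreover have "integral {s..t} (\<lambda>r. l' r \<bullet> (y t - y r))
      = integral {s..t} (\<lambda>r. l' r \<bullet> y t) - integral {s..t} (\<lambda>r. l' r \<bullet> y r)"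
    unfolding inner_diff_right using rate_integrable st by (intro integral_diff) auto
  moreover have "integral {s..t} (\<lambda>r. l' r \<bullet> y t) = (l t - l s) \<bullet> y t"
    using integral_linear[OF rate_integrable(1) bounded_linear_inner_left, of s t "y t"] load_increment[of s t] st
    by (simp add: o_def)
  ultimately show ?thesis
    by (simp add: inner_diff_left inner_diff_right)
qed

text \<open>Admissibility of the force at \<open>s\<close> cancels \<open>D\<close> against the
  linear term of \<open>dissipation_increment\<close>.\<close>

lemma increment_le_integral:
  assumes st: "0 \<le> s" "s \<le> t" "t \<le> T"
  shows "\<alpha> / 2 * (norm (y t - y s))\<^sup>2 \<le> integral {s..t} (\<lambda>r. l' r \<bullet> (y t - y r))"
  using dissipation_increment[OF st] evolution_force[of s "y t - y s"] evolution_in_V[of s] evolution_in_V[of t] st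
  by (simp add: in_V)

lemma integral_rate_le:
  assumes st: "0 \<le> s" "t \<le> T" and B: "\<And>r. r \<in> {s..t} \<Longrightarrow> norm (y t - y r) \<le> B"
  shows "integral {s..t} (\<lambda>r. l' r \<bullet> (y t - y r)) \<le> B * integral {s..t} (\<lambda>r. norm (l' r))"
proof -
  have "integral {s..t} (\<lambda>r. l' r \<bullet> (y t - y r)) \<le> integral {s..t} (\<lambda>r. B * norm (l' r))"
  proof (rule integral_le)
    show "(\<lambda>r. l' r \<bullet> (y t - y r)) integrable_on {s..t}"
      unfolding inner_diff_right using rate_integrable st by (intro integrable_diff) auto
    show "(\<lambda>r. B * norm (l' r)) integrable_on {s..t}"
      using rate_integrable(2)[OF st] by (rule integrable_on_mult_right)
    fix r assume "r \<in> {s..t}"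
    then show "l' r \<bullet> (y t - y r) \<le> B * norm (l' r)"
      using norm_cauchy_schwarz[of "l' r" "y t - y r"] mult_right_mono[OF B[of r] norm_ge_zero[of "l' r"]]
      by (simp add: mult.commute)
  qed
  then show ?thesis by simp
qed

text \<open>Makes the suprema taken later finite. The increment from time 0 satisfies a quadratic
  inequality whose right-hand side is affine in the increment itself.\<close>

lemma evolution_bounded:
  assumes "0 \<le> T"
  obtains B where "\<And>t. t \<in> {0..T} \<Longrightarrow> norm (y t) \<le> B"
proof -
  define Q where "Q = integral {0..T} (\<lambda>r. norm (l' r))"
  define R where "R = integral {0..T} (\<lambda>r. \<bar>l' r \<bullet> y r\<bar>)"
  have QR: "0 \<le> Q" "0 \<le> R"
    unfolding Q_def R_def by (intro integral_nonneg rate_integrable; simp)+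
  have "norm (y t) \<le> norm (y 0) + (1 + 2 / \<alpha> * (Q + (Q * norm (y 0) + R)))" if t: "t \<in> {0..T}" for t
  proof -
    define u where "u = norm (y t - y 0)"
    have yt: "norm (y t) \<le> u + norm (y 0)"
      unfolding u_def using norm_triangle_ineq[of "y t - y 0" "y 0"] by simp
    have "\<alpha> / 2 * u\<^sup>2 \<le> integral {0..t} (\<lambda>r. l' r \<bullet> (y t - y r))"
      using increment_le_integral[of 0 t] t by (simp add: u_def)
    also have "\<dots> \<le> integral {0..t} (\<lambda>r. norm (y t) * norm (l' r) + \<bar>l' r \<bullet> y r\<bar>)"
    proof (rule integral_le)
      show "(\<lambda>r. l' r \<bullet> (y t - y r)) integrable_on {0..t}"
        unfolding inner_diff_right using rate_integrable t by (intro integrable_diff) auto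
      show "(\<lambda>r. norm (y t) * norm (l' r) + \<bar>l' r \<bullet> y r\<bar>) integrable_on {0..t}"
        using rate_integrable t by (intro integrable_add integrable_on_mult_right) auto
      show "l' r \<bullet> (y t - y r) \<le> norm (y t) * norm (l' r) + \<bar>l' r \<bullet> y r\<bar>" for r
        using norm_cauchy_schwarz[of "l' r" "y t"] by (simp add: inner_diff_right mult.commute)
    qed
    also have "\<dots> \<le> integral {0..T} (\<lambda>r. norm (y t) * norm (l' r) + \<bar>l' r \<bullet> y r\<bar>)"
      using rate_integrable t by (intro integral_subset_le integrable_add integrable_on_mult_right) auto
    also have "\<dots> = norm (y t) * Q + R"
      unfolding Q_def R_def using rate_integrable
      by (subst integral_add) (auto intro!: integrable_on_mult_right)
    also have "\<dots> \<le> (u + norm (y 0)) * Q + R"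
      using yt QR by (intro add_right_mono mult_right_mono)
    finally have main: "\<alpha> / 2 * u\<^sup>2 \<le> (u + norm (y 0)) * Q + R" .
    have u: "u \<le> 1 + 2 / \<alpha> * (Q + (Q * norm (y 0) + R))"
    \<comment> \<open>For \<open>u > 1\<close> the constant terms are at most \<open>u\<close> times
      themselves, so a factor \<open>u\<close> can be divided out; the other case accounts for the
      summand 1.\<close>
    proof (cases "u \<le> 1")
      case True
      have "0 \<le> 2 / \<alpha> * (Q + (Q * norm (y 0) + R))"
        using QR \<alpha> by (intro mult_nonneg_nonneg add_nonneg_nonneg) auto
      then show ?thesis using True by linarith
    next
      case False
      have "1 * (Q * norm (y 0) + R) \<le> u * (Q * norm (y 0) + R)"
        using False QR by (intro mult_right_mono) auto
      with main have "u * (\<alpha> / 2 * u) \<le> u * (Q + (Q * norm (y 0) + R))"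
        by (simp add: power2_eq_square algebra_simps)
      then have "\<alpha> / 2 * u \<le> Q + (Q * norm (y 0) + R)"
        using False by simp
      then have "u \<le> 2 / \<alpha> * (Q + (Q * norm (y 0) + R))"
        using \<alpha> by (simp add: field_simps)
      then show ?thesis by simp
    qed
    show ?thesis using u yt by linarith
  qed
  then show ?thesis using that by blast
qed

text \<open>For the supremum \<open>K\<close> of the distances to the end state \<open>y t\<close>,
  the integral estimate gives \<open>\<alpha> / 2 * K\<^sup>2 \<le> K * Q\<close>; cancelling
  \<open>K\<close> leaves a linear bound.\<close>

lemma evolution_increment:
  assumes st: "0 \<le> s" "s \<le> t" "t \<le> T"
  shows "norm (y t - y s) \<le> 2 / \<alpha> * integral {s..t} (\<lambda>r. norm (l' r))"
    and "integral {s..t} (\<lambda>r. l' r \<bullet> (y t - y r)) \<le> 2 / \<alpha> * (integral {s..t} (\<lambda>r. norm (l' r)))\<^sup>2"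
proof -
  define Q where "Q = integral {s..t} (\<lambda>r. norm (l' r))"
  obtain B where B: "\<And>t. t \<in> {0..T} \<Longrightarrow> norm (y t) \<le> B"
    using evolution_bounded st by auto
  define K where "K = (SUP r\<in>{s..t}. norm (y t - y r))"
  have "norm (y t - y r) \<le> B + B" if "r \<in> {s..t}" for r
    using norm_triangle_ineq4[of "y t" "y r"] B[of t] B[of r] st that by simp
  then have "bdd_above ((\<lambda>r. norm (y t - y r)) ` {s..t})"
    by (intro bdd_aboveI2)
  then have le_K: "norm (y t - y r) \<le> K" if "r \<in> {s..t}" for r
    unfolding K_def using that by (intro cSUP_upper)
  have K0: "0 \<le> K"
    using le_K[of t] st by simp
  have Q0: "0 \<le> Q"
    unfolding Q_def using rate_integrable st by (intro integral_nonneg) auto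
  have "norm (y t - y r) \<le> sqrt (2 / \<alpha> * (K * Q))" if r: "r \<in> {s..t}" for r
  proof -
    have "\<alpha> / 2 * (norm (y t - y r))\<^sup>2 \<le> integral {r..t} (\<lambda>q. l' q \<bullet> (y t - y q))"
      using increment_le_integral[of r t] st r by simp
    also have "\<dots> \<le> K * integral {r..t} (\<lambda>q. norm (l' q))"
      using st r by (intro integral_rate_le le_K) auto
    also have "\<dots> \<le> K * Q"
      unfolding Q_def using rate_integrable st r K0
      by (intro mult_left_mono integral_subset_le) auto
    finally have "(norm (y t - y r))\<^sup>2 \<le> 2 / \<alpha> * (K * Q)"
      using \<alpha> by (simp add: field_simps)
    then show ?thesis
      by (rule real_le_rsqrt)
  qed
  then have "K \<le> sqrt (2 / \<alpha> * (K * Q))"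
    unfolding K_def using st by (intro cSUP_least) auto
  then have "K\<^sup>2 \<le> (sqrt (2 / \<alpha> * (K * Q)))\<^sup>2"
    using K0 by (rule power_mono)
  also have "\<dots> = 2 / \<alpha> * (K * Q)"
    using K0 Q0 \<alpha> by simp
  finally have "K * K \<le> K * (2 / \<alpha> * Q)"
    by (simp add: power2_eq_square mult.left_commute)
  \<comment> \<open>Covers \<open>K = 0\<close>, where the factor cannot be cancelled.\<close>
  moreover have "0 \<le> 2 / \<alpha> * Q"
    using Q0 \<alpha> by simp
  ultimately have K: "K \<le> 2 / \<alpha> * Q"
    using K0 by (metis mult_left_le_imp_le order_le_less)
  show "norm (y t - y s) \<le> 2 / \<alpha> * integral {s..t} (\<lambda>r. norm (l' r))"
    using le_K[of s] K st by (simp add: Q_def)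
  have "integral {s..t} (\<lambda>r. l' r \<bullet> (y t - y r)) \<le> K * Q"
    unfolding Q_def using st by (intro integral_rate_le le_K) auto
  also have "\<dots> \<le> 2 / \<alpha> * Q * Q"
    using K Q0 by (rule mult_right_mono)
  finally show "integral {s..t} (\<lambda>r. l' r \<bullet> (y t - y r)) \<le> 2 / \<alpha> * (integral {s..t} (\<lambda>r. norm (l' r)))\<^sup>2"
    by (simp add: Q_def power2_eq_square)
qed

text \<open>Counterpart of \<open>evolution_force\<close>: on the evolution's own increment the
  force attains the bound by \<open>D\<close> up to a quadratic error.\<close>

lemma dissipation_increment_quadratic:
  assumes st: "0 \<le> s" "s \<le> t" "t \<le> T"
  shows "D (y t - y s) \<le> (l s - G (y s)) \<bullet> (y t - y s) + 2 / \<alpha> * (integral {s..t} (\<lambda>r. norm (l' r)))\<^sup>2"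
proof -
  have "0 \<le> \<alpha> / 2 * (norm (y t - y s))\<^sup>2"
    using \<alpha> by simp
  then show ?thesis
    using dissipation_increment[OF st] evolution_increment(2)[OF st] by linarith
qed

end

section \<open>The gap between two states\<close>

text \<open>The symmetrized Bregman distance of \<open>f\<close>.\<close>

definition gap :: "'a \<Rightarrow> 'a \<Rightarrow> real"
  where "gap x y = (G x - G y) \<bullet> (x - y)"

lemma gap_ge: "\<lbrakk>x \<in> V; y \<in> V\<rbrakk> \<Longrightarrow> \<alpha> * (norm (x - y))\<^sup>2 \<le> gap x y"
  unfolding gap_def by (rule G_strongly_monotone)

lemma gap_le: "\<lbrakk>x \<in> V; y \<in> V\<rbrakk> \<Longrightarrow> gap x y \<le> M * (norm (x - y))\<^sup>2"
proof -
  assume "x \<in> V" "y \<in> V"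
  then have "norm (G x - G y) * norm (x - y) \<le> M * norm (x - y) * norm (x - y)"
    by (intro mult_right_mono G_lipschitz) auto
  then show ?thesis
    using norm_cauchy_schwarz[of "G x - G y" "x - y"] by (simp add: gap_def power2_eq_square)
qed

text \<open>The leading term arises once from displacing the points and once more from displacing
  the gradients, after \<open>G_increment\<close> has traded their increments; hence the factor
  2.\<close>

lemma gap_add_le:
  assumes V: "x \<in> V" "y \<in> V" "h \<in> V" "k \<in> V"
  shows "gap (x + h) (y + k) - gap x y \<le> 2 * ((G x - G y) \<bullet> (h - k))
    + L * (norm (x - y))\<^sup>2 * (norm h + norm k) + (L * norm (x - y) + M) * (norm h + norm k)\<^sup>2"
proof -
  let ?d = "x - y"
  define X where "X = G (x + h) - G x"
  define Y where "Y = G (y + k) - G y"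
  have "gap (x + h) (y + k) - gap x y = (G x - G y) \<bullet> (h - k) + X \<bullet> ?d - Y \<bullet> ?d + (X - Y) \<bullet> (h - k)"
    unfolding gap_def X_def Y_def by (simp add: inner_simps)
  moreover have "X \<bullet> ?d \<le> (G x - G y) \<bullet> h + L * (norm ?d)\<^sup>2 * norm h + L * norm ?d * (norm h)\<^sup>2"
    using G_increment[of x y h] V unfolding X_def
    by (simp add: inner_simps norm_minus_commute abs_le_iff)
  moreover have "- (Y \<bullet> ?d) \<le> - ((G x - G y) \<bullet> k) + L * (norm ?d)\<^sup>2 * norm k + L * norm ?d * (norm k)\<^sup>2"
    using G_increment[of y x k] V unfolding Y_def
    by (simp add: inner_simps abs_le_iff)
  moreover have "(X - Y) \<bullet> (h - k) \<le> M * (norm h + norm k)\<^sup>2"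
  proof -
    have "norm X \<le> M * norm h" "norm Y \<le> M * norm k"
      using G_lipschitz[of "x + h" x] G_lipschitz[of "y + k" y] V by (auto simp: X_def Y_def in_V)
    then have "norm (X - Y) \<le> M * (norm h + norm k)"
      using norm_triangle_ineq4[of X Y] by (simp add: distrib_left)
    then have "norm (X - Y) * norm (h - k) \<le> (M * (norm h + norm k)) * (norm h + norm k)"
      using M by (intro mult_mono norm_triangle_ineq4) auto
    then show ?thesis
      using norm_cauchy_schwarz[of "X - Y" "h - k"] by (simp add: power2_eq_square)
  qed
  moreover have "L * norm ?d * ((norm h)\<^sup>2 + (norm k)\<^sup>2) \<le> L * norm ?d * (norm h + norm k)\<^sup>2"
    using L by (intro mult_left_mono) (auto simp: power2_sum)
  ultimately show ?thesis
    by (simp add: inner_simps algebra_simps)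
qed

section \<open>Comparison of two evolutions\<close>

context
  fixes T l1 l1' y1 l2 l2' y2
  assumes ev1: "evolution T l1 l1' y1" and ev2: "evolution T l2 l2' y2"
begin

text \<open>Each evolution dissipates the most among all admissible forces, up to a quadratic error;
  testing with the force of the other one shows that the forces move monotonically.\<close>

lemma forces_monotone:
  assumes st: "0 \<le> s" "s \<le> t" "t \<le> T"
    and q: "q = integral {s..t} (\<lambda>r. norm (l1' r)) + integral {s..t} (\<lambda>r. norm (l2' r))"
  shows "(G (y1 s) - G (y2 s)) \<bullet> ((y1 t - y1 s) - (y2 t - y2 s))
    \<le> (l1 s - l2 s) \<bullet> ((y1 t - y1 s) - (y2 t - y2 s)) + 2 / \<alpha> * q\<^sup>2"
proof -
  define q1 where "q1 = integral {s..t} (\<lambda>r. norm (l1' r))"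
  define q2 where "q2 = integral {s..t} (\<lambda>r. norm (l2' r))"
  have q0: "0 \<le> q1" "0 \<le> q2"
    unfolding q1_def q2_def using rate_integrable(2)[OF ev1] rate_integrable(2)[OF ev2] st
    by (intro integral_nonneg; simp)+
  have yV: "y1 s \<in> V" "y1 t \<in> V" "y2 s \<in> V" "y2 t \<in> V"
    using evolution_in_V[OF ev1] evolution_in_V[OF ev2] st by auto
  have "(l2 s - G (y2 s)) \<bullet> (y1 t - y1 s) \<le> (l1 s - G (y1 s)) \<bullet> (y1 t - y1 s) + 2 / \<alpha> * q1\<^sup>2"
    using evolution_force[OF ev2, of s "y1 t - y1 s"] dissipation_increment_quadratic[OF ev1 st] yV st
    by (simp add: in_V q1_def)
  moreover have "(l1 s - G (y1 s)) \<bullet> (y2 t - y2 s) \<le> (l2 s - G (y2 s)) \<bullet> (y2 t - y2 s) + 2 / \<alpha> * q2\<^sup>2"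
    using evolution_force[OF ev1, of s "y2 t - y2 s"] dissipation_increment_quadratic[OF ev2 st] yV st
    by (simp add: in_V q2_def)
  moreover have "2 / \<alpha> * (q1\<^sup>2 + q2\<^sup>2) \<le> 2 / \<alpha> * q\<^sup>2"
    unfolding q q1_def[symmetric] q2_def[symmetric]
    using q0 \<alpha> by (intro mult_left_mono) (auto simp: power2_sum)
  ultimately show ?thesis
    by (simp add: inner_simps distrib_left)
qed

text \<open>In \<open>gap_add_le\<close>, \<open>forces_monotone\<close> replaces gradients by
  loads, and \<open>evolution_increment\<close> bounds the state increments by
  \<open>2 / \<alpha> * q\<close>. The last coefficient collects the doubled error of the forces and
  the squared increments.\<close>

lemma gap_increment:
  assumes st: "0 \<le> s" "s \<le> t" "t \<le> T"
    and q: "q = integral {s..t} (\<lambda>r. norm (l1' r)) + integral {s..t} (\<lambda>r. norm (l2' r))"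
    and K: "norm (y1 s - y2 s) \<le> K"
  shows "gap (y1 t) (y2 t) - gap (y1 s) (y2 s)
    \<le> 2 * ((l1 s - l2 s) \<bullet> ((y1 t - y2 t) - (y1 s - y2 s)))
      + 2 * L / \<alpha> * (norm (y1 s - y2 s))\<^sup>2 * q + (4 / \<alpha> + (L * K + M) * (4 / \<alpha>\<^sup>2)) * q\<^sup>2"
proof -
  let ?h = "y1 t - y1 s" and ?k = "y2 t - y2 s" and ?d = "y1 s - y2 s"
  have yV: "y1 s \<in> V" "y1 t \<in> V" "y2 s \<in> V" "y2 t \<in> V"
    using evolution_in_V[OF ev1] evolution_in_V[OF ev2] st by auto
  have hk: "norm ?h + norm ?k \<le> 2 / \<alpha> * q"
    using evolution_increment(1)[OF ev1 st] evolution_increment(1)[OF ev2 st] by (simp add: q distrib_left)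
  have "gap (y1 t) (y2 t) - gap (y1 s) (y2 s) \<le> 2 * ((G (y1 s) - G (y2 s)) \<bullet> (?h - ?k))
      + L * (norm ?d)\<^sup>2 * (norm ?h + norm ?k) + (L * norm ?d + M) * (norm ?h + norm ?k)\<^sup>2"
    using gap_add_le[of "y1 s" "y2 s" ?h ?k] yV by (simp add: in_V)
  moreover have "(G (y1 s) - G (y2 s)) \<bullet> (?h - ?k) \<le> (l1 s - l2 s) \<bullet> (?h - ?k) + 2 / \<alpha> * q\<^sup>2"
    by (rule forces_monotone[OF st q])
  moreover have "L * (norm ?d)\<^sup>2 * (norm ?h + norm ?k) \<le> L * (norm ?d)\<^sup>2 * (2 / \<alpha> * q)"
    using hk L by (intro mult_left_mono) auto
  moreover have "(L * norm ?d + M) * (norm ?h + norm ?k)\<^sup>2 \<le> (L * K + M) * (2 / \<alpha> * q)\<^sup>2"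
    using hk L M K by (intro mult_mono add_mono mult_left_mono power_mono) (auto intro: add_nonneg_nonneg mult_nonneg_nonneg order_trans[OF norm_ge_zero])
  moreover have "?h - ?k = (y1 t - y2 t) - (y1 s - y2 s)"
    by simp
  ultimately show ?thesis
    by (simp add: power_mult_distrib power_divide algebra_simps)
qed

lemma rate_diff_integrable:
  assumes "0 \<le> s" "t \<le> T"
  shows "(\<lambda>r. norm (l1' r - l2' r)) integrable_on {s..t}"
proof -
  have "(\<lambda>r. l1' r - l2' r) absolutely_integrable_on {0..T}"
    using ev1 ev2 by (intro set_integral_diff) (auto simp: evolution_def)
  then have "(\<lambda>r. norm (l1' r - l2' r)) integrable_on {0..T}"
    by (simp add: absolutely_integrable_on_def)
  then show ?thesis
    by (rule integrable_on_subinterval) (use assms in auto)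
qed

lemma load_diff_increment:
  assumes st: "0 \<le> s" "s \<le> t" "t \<le> T"
  shows "norm ((l1 t - l2 t) - (l1 s - l2 s)) \<le> integral {s..t} (\<lambda>r. norm (l1' r - l2' r))"
proof -
  have int: "l1' integrable_on {s..t}" "l2' integrable_on {s..t}"
    using rate_integrable(1)[OF ev1] rate_integrable(1)[OF ev2] st by auto
  have "(l1 t - l2 t) - (l1 s - l2 s) = integral {s..t} (\<lambda>r. l1' r - l2' r)"
    using load_increment[OF ev1 st] load_increment[OF ev2 st] int
    by (simp add: integral_diff algebra_simps)
  also have "norm \<dots> \<le> integral {s..t} (\<lambda>r. norm (l1' r - l2' r))"
    using int rate_diff_integrable st by (intro integral_norm_bound_integral integrable_diff) auto
  finally show ?thesis .
qed

text \<open>Gronwall's argument in the form of \<open>antimono_if_increments_quadratic\<close>. The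
  a priori bound \<open>K\<close> enters the result only linearly, so it can be absorbed once it is
  taken as the supremum of the difference.\<close>

lemma difference_bound:
  assumes \<tau>: "\<tau> \<in> {0..T}"
    and K: "\<And>t. t \<in> {0..\<tau>} \<Longrightarrow> norm (y1 t - y2 t) \<le> K"
    and N: "N = integral {0..\<tau>} (\<lambda>r. norm (l1' r - l2' r))"
    and P: "P = integral {0..\<tau>} (\<lambda>r. norm (l1' r)) + integral {0..\<tau>} (\<lambda>r. norm (l2' r))"
  shows "\<alpha> * (norm (y1 \<tau> - y2 \<tau>))\<^sup>2
    \<le> exp (2 * L / \<alpha>\<^sup>2 * P) * (M * (norm (y1 0 - y2 0))\<^sup>2 + (4 * norm (l1 0 - l2 0) + 4 * N) * K)"
proof -
  define d where "d t = y1 t - y2 t" for t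
  define \<mu> where "\<mu> t = l1 t - l2 t" for t
  define n where "n t = integral {0..t} (\<lambda>r. norm (l1' r - l2' r))" for t
  define p where "p t = integral {0..t} (\<lambda>r. norm (l1' r)) + integral {0..t} (\<lambda>r. norm (l2' r))" for t
  \<comment> \<open>The factor \<open>2 * L / \<alpha>\<close> of \<open>gap_increment\<close>,
    divided by \<open>\<alpha>\<close> once more because \<open>\<psi>\<close> dominates
    \<open>\<alpha>\<close> times the squared difference.\<close>
  define \<kappa> where "\<kappa> = 2 * L / \<alpha>\<^sup>2"
  define \<Lambda> where "\<Lambda> = norm (\<mu> 0) + N"
  txt \<open>Subtracting \<open>2 (\<mu> \<bullet> d)\<close> is a summation by parts that moves the increments from \<open>d\<close> to the load
    difference \<open>\<mu>\<close>; the last two terms keep \<open>\<psi> \<ge> \<alpha> \<bar>d\<bar>\<^sup>2\<close> and absorb the increments of \<open>\<mu>\<close>.\<close>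
  define \<psi> where "\<psi> t = gap (y1 t) (y2 t) - 2 * (\<mu> t \<bullet> d t) + 2 * \<Lambda> * K + 2 * K * (N - n t)" for t
  define \<Phi> where "\<Phi> t = \<psi> t * exp (- \<kappa> * p t)" for t
  define C where "C = 4 / \<alpha> + (L * K + M) * (4 / \<alpha>\<^sup>2)"
  have K0: "0 \<le> K"
    using K[of 0] \<tau> norm_ge_zero order_trans by (metis atLeastAtMost_iff order_refl)
  have \<kappa>0: "0 \<le> \<kappa>" and C0: "0 \<le> C"
    using L M K0 \<alpha> by (auto simp: \<kappa>_def C_def)
  have int1: "(\<lambda>r. norm (l1' r)) integrable_on {s..t}" and int2: "(\<lambda>r. norm (l2' r)) integrable_on {s..t}"
    and intd: "(\<lambda>r. norm (l1' r - l2' r)) integrable_on {s..t}" if "0 \<le> s" "t \<le> \<tau>" for s t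
    using rate_integrable(2)[OF ev1] rate_integrable(2)[OF ev2] rate_diff_integrable that \<tau> by auto
  have yV: "y1 t \<in> V" "y2 t \<in> V" if "t \<in> {0..\<tau>}" for t
    using evolution_in_V[OF ev1] evolution_in_V[OF ev2] that \<tau> by auto
  have n_diff: "n t - n s = integral {s..t} (\<lambda>r. norm (l1' r - l2' r))"
    and p_diff: "p t - p s = integral {s..t} (\<lambda>r. norm (l1' r)) + integral {s..t} (\<lambda>r. norm (l2' r))"
    if st: "0 \<le> s" "s \<le> t" "t \<le> \<tau>" for s t
    unfolding n_def p_def
    using Henstock_Kurzweil_Integration.integral_combine[OF st(1,2) intd[of 0 t]]
      Henstock_Kurzweil_Integration.integral_combine[OF st(1,2) int1[of 0 t]]
      Henstock_Kurzweil_Integration.integral_combine[OF st(1,2) int2[of 0 t]] st by auto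
  have n_mono: "0 \<le> n t - n s" and p_mono: "0 \<le> p t - p s" if st: "0 \<le> s" "s \<le> t" "t \<le> \<tau>" for s t
    unfolding n_diff[OF st] p_diff[OF st] using int1 int2 intd st
    by (auto intro!: integral_nonneg add_nonneg_nonneg)
  have ends: "n 0 = 0" "p 0 = 0" "n \<tau> = N" "p \<tau> = P"
    by (simp_all add: n_def p_def N P)
  have n_bounds: "0 \<le> n t" "n t \<le> N" and p_nonneg: "0 \<le> p t" if "t \<in> {0..\<tau>}" for t
    using n_mono[of 0 t] n_mono[of t \<tau>] p_mono[of 0 t] that ends by auto
  have \<mu>_diff: "norm (\<mu> t - \<mu> s) \<le> n t - n s" if "0 \<le> s" "s \<le> t" "t \<le> \<tau>" for s t
    using load_diff_increment[of s t] n_diff[OF that] that \<tau> by (simp add: \<mu>_def)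
  have \<mu>_le: "norm (\<mu> t) \<le> \<Lambda>" if "t \<in> {0..\<tau>}" for t
    using \<mu>_diff[of 0 t] n_bounds(2)[OF that] norm_triangle_ineq2[of "\<mu> t" "\<mu> 0"] that ends
    by (simp add: \<Lambda>_def)
  have d_le: "norm (d t) \<le> K" if "t \<in> {0..\<tau>}" for t
    using K that by (simp add: d_def)
  have \<mu>d: "\<bar>\<mu> t \<bullet> d t\<bar> \<le> \<Lambda> * K" if "t \<in> {0..\<tau>}" for t
    using Cauchy_Schwarz_ineq2[of "\<mu> t" "d t"] mult_mono[OF \<mu>_le[OF that] d_le[OF that]] \<mu>_le[OF that]
    by (smt (verit) norm_ge_zero)
  have \<psi>_ge: "\<alpha> * (norm (d t))\<^sup>2 \<le> \<psi> t" if t: "t \<in> {0..\<tau>}" for t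
  proof -
    have "\<alpha> * (norm (d t))\<^sup>2 \<le> gap (y1 t) (y2 t)"
      unfolding d_def by (intro gap_ge yV t)
    moreover have "0 \<le> 2 * K * (N - n t)"
      using K0 n_bounds[OF t] by simp
    ultimately show ?thesis
      using \<mu>d[OF t] by (simp add: \<psi>_def abs_le_iff)
  qed
  have \<psi>_step: "\<psi> t \<le> \<psi> s * (1 + \<kappa> * (p t - p s)) + C * (p t - p s)\<^sup>2"
    if st: "0 \<le> s" "s \<le> t" "t \<le> \<tau>" for s t
  proof -
    have "gap (y1 t) (y2 t) - gap (y1 s) (y2 s)
        \<le> 2 * (\<mu> s \<bullet> (d t - d s)) + 2 * L / \<alpha> * (norm (d s))\<^sup>2 * (p t - p s) + C * (p t - p s)\<^sup>2"
      unfolding \<mu>_def d_def C_def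
      using gap_increment[OF st(1,2) _ p_diff[OF st] K] st \<tau> by auto
    \<comment> \<open>The increment of \<open>\<mu> \<bullet> d\<close> splits into
      \<open>\<mu> s \<bullet> (d t - d s)\<close>, which cancels the load term of the gap, and this
      remainder, which the decrease of \<open>2 * K * (N - n t)\<close> absorbs.\<close>
    moreover have "- ((\<mu> t - \<mu> s) \<bullet> d t) \<le> K * (n t - n s)"
    proof -
      have "- ((\<mu> t - \<mu> s) \<bullet> d t) \<le> norm (\<mu> t - \<mu> s) * norm (d t)"
        using Cauchy_Schwarz_ineq2[of "\<mu> t - \<mu> s" "d t"] by simp
      also have "\<dots> \<le> (n t - n s) * K"
        using \<mu>_diff[OF st] d_le[of t] n_mono[OF st] st by (intro mult_mono) auto
      finally show ?thesis by (simp add: mult.commute)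
    qed
    moreover have "2 * L / \<alpha> * (norm (d s))\<^sup>2 * (p t - p s) \<le> \<kappa> * \<psi> s * (p t - p s)"
    proof (rule mult_right_mono[OF _ p_mono[OF st]])
      have "2 * L / \<alpha> * (norm (d s))\<^sup>2 = \<kappa> * (\<alpha> * (norm (d s))\<^sup>2)"
        using \<alpha> by (simp add: \<kappa>_def power2_eq_square)
      also have "\<dots> \<le> \<kappa> * \<psi> s"
        using \<psi>_ge[of s] \<kappa>0 st by (intro mult_left_mono) auto
      finally show "2 * L / \<alpha> * (norm (d s))\<^sup>2 \<le> \<kappa> * \<psi> s" .
    qed
    ultimately show ?thesis
      by (simp add: \<psi>_def inner_simps algebra_simps)
  qed
  have "\<Phi> \<tau> \<le> \<Phi> 0"
  proof (rule antimono_if_increments_quadratic[where \<Phi> = \<Phi> and P = p and K = C])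
    show "0 \<le> \<tau>" using \<tau> by simp
    show "continuous_on {0..\<tau>} p"
      unfolding p_def[abs_def] by (intro continuous_on_add indefinite_integral_continuous_1 int1 int2) auto
    fix s t assume st: "0 \<le> s" "s \<le> t" "t \<le> \<tau>"
    show "p s \<le> p t"
      using p_mono[OF st] by simp
    have \<psi>0: "0 \<le> \<psi> s"
      using \<psi>_ge[of s] \<alpha> st by (auto intro: order_trans[rotated])
    \<comment> \<open>By \<open>1 + x \<le> exp x\<close> the growth factor becomes a ratio of
      exponentials, which the weight in \<open>\<Phi>\<close> cancels.\<close>
    have "\<psi> t \<le> \<psi> s * exp (\<kappa> * (p t - p s)) + C * (p t - p s)\<^sup>2"
      using \<psi>_step[OF st] mult_left_mono[OF exp_ge_add_one_self[of "\<kappa> * (p t - p s)"] \<psi>0] by linarith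
    then have "\<psi> t * exp (- \<kappa> * p t)
        \<le> (\<psi> s * exp (\<kappa> * (p t - p s)) + C * (p t - p s)\<^sup>2) * exp (- \<kappa> * p t)"
      by (rule mult_right_mono) simp
    also have "\<dots> = \<psi> s * (exp (\<kappa> * (p t - p s)) * exp (- \<kappa> * p t)) + C * (p t - p s)\<^sup>2 * exp (- \<kappa> * p t)"
      by (simp add: algebra_simps)
    also have "exp (\<kappa> * (p t - p s)) * exp (- \<kappa> * p t) = exp (- \<kappa> * p s)"
      by (simp add: exp_add[symmetric] algebra_simps)
    also have "C * (p t - p s)\<^sup>2 * exp (- \<kappa> * p t) \<le> C * (p t - p s)\<^sup>2 * 1"
      using C0 \<kappa>0 p_nonneg[of t] st by (intro mult_left_mono) auto
    finally show "\<Phi> t - \<Phi> s \<le> C * (p t - p s)\<^sup>2"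
      by (simp add: \<Phi>_def)
  qed
  then have "exp (\<kappa> * P) * (\<psi> \<tau> * exp (- \<kappa> * P)) \<le> exp (\<kappa> * P) * \<psi> 0"
    by (simp add: \<Phi>_def ends)
  also have "exp (\<kappa> * P) * (\<psi> \<tau> * exp (- \<kappa> * P)) = \<psi> \<tau>"
    by (simp add: exp_minus field_simps)
  also have "\<psi> 0 \<le> M * (norm (d 0))\<^sup>2 + (4 * norm (\<mu> 0) + 4 * N) * K"
  proof -
    have 0: "0 \<in> {0..\<tau>}" using \<tau> by simp
    \<comment> \<open>Both coefficients 4 are sums of two contributions: \<open>\<Lambda>\<close>
      contains \<open>norm (\<mu> 0)\<close> and \<open>N\<close>, the former also occurs here, and
      the latter in \<open>2 * K * (N - n 0)\<close>.\<close>
    have "- (\<mu> 0 \<bullet> d 0) \<le> norm (\<mu> 0) * K"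
      using Cauchy_Schwarz_ineq2[of "\<mu> 0" "d 0"] mult_left_mono[OF d_le[OF 0], of "norm (\<mu> 0)"] by simp
    then show ?thesis
      using gap_le[OF yV[OF 0]] by (simp add: \<psi>_def \<Lambda>_def ends d_def algebra_simps)
  qed
  finally have "\<psi> \<tau> \<le> exp (\<kappa> * P) * (M * (norm (d 0))\<^sup>2 + (4 * norm (\<mu> 0) + 4 * N) * K)"
    by simp
  then show ?thesis
    using \<psi>_ge[of \<tau>] \<tau> by (simp add: d_def \<mu>_def \<kappa>_def)
qed

text \<open>\<open>difference_bound\<close>, applied up to every time in \<open>[0, t]\<close> with
  \<open>K\<close> the supremum of the difference there, gives a quadratic inequality for
  \<open>K\<close>. Bounding the variation of the loads on all of \<open>[0, T]\<close> by
  \<open>P\<close> makes the constant independent of \<open>t\<close>.\<close>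

lemma evolution_stability:
  assumes t: "t \<in> {0..T}"
    and initial: "norm (l1 0 - l2 0) \<le> M * norm (y1 0 - y2 0)"
    and P: "integral {0..T} (\<lambda>r. norm (l1' r)) + integral {0..T} (\<lambda>r. norm (l2' r)) \<le> P"
    and A: "A = exp (2 * L / \<alpha>\<^sup>2 * P) / \<alpha>"
  shows "(norm (y1 t - y2 t))\<^sup>2 \<le> (2 * A * M + 32 * A\<^sup>2 * M\<^sup>2 + 32 * A\<^sup>2) *
    ((norm (y1 0 - y2 0))\<^sup>2 + (integral {0..t} (\<lambda>r. norm (l1' r - l2' r)))\<^sup>2)"
proof -
  define N where "N = integral {0..t} (\<lambda>r. norm (l1' r - l2' r))"
  define a where "a = norm (y1 0 - y2 0)"
  define K where "K = (SUP s\<in>{0..t}. norm (y1 s - y2 s))"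
  define Q where "Q = 4 * M * a + 4 * N"
  obtain B1 B2 where "\<And>s. s \<in> {0..T} \<Longrightarrow> norm (y1 s) \<le> B1" "\<And>s. s \<in> {0..T} \<Longrightarrow> norm (y2 s) \<le> B2"
    using evolution_bounded[OF ev1] evolution_bounded[OF ev2] t by (metis atLeastAtMost_iff order_trans)
  then have "norm (y1 s - y2 s) \<le> B1 + B2" if "s \<in> {0..t}" for s
    using norm_triangle_ineq4[of "y1 s" "y2 s"] that t by (meson add_mono atLeastAtMost_iff order_trans)
  then have "bdd_above ((\<lambda>s. norm (y1 s - y2 s)) ` {0..t})"
    by (intro bdd_aboveI2)
  then have le_K: "norm (y1 s - y2 s) \<le> K" if "s \<in> {0..t}" for s
    unfolding K_def using that by (intro cSUP_upper)
  have K0: "0 \<le> K"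
    using order_trans[OF norm_ge_zero le_K[of t]] t by simp
  have N0: "0 \<le> N"
    unfolding N_def using rate_diff_integrable t by (intro integral_nonneg) auto
  have A0: "0 \<le> A"
    using \<alpha> by (simp add: A)
  have a0: "0 \<le> a" by (simp add: a_def)
  have "norm (y1 \<tau> - y2 \<tau>) \<le> sqrt (A * (M * a\<^sup>2 + Q * K))" if \<tau>: "\<tau> \<in> {0..t}" for \<tau>
  proof -
    define n where "n = integral {0..\<tau>} (\<lambda>r. norm (l1' r - l2' r))"
    define p where "p = integral {0..\<tau>} (\<lambda>r. norm (l1' r)) + integral {0..\<tau>} (\<lambda>r. norm (l2' r))"
    have "\<alpha> * (norm (y1 \<tau> - y2 \<tau>))\<^sup>2
        \<le> exp (2 * L / \<alpha>\<^sup>2 * p) * (M * a\<^sup>2 + (4 * norm (l1 0 - l2 0) + 4 * n) * K)"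
      unfolding a_def by (rule difference_bound[OF _ _ n_def p_def]) (use \<tau> t le_K in auto)
    also have "\<dots> \<le> exp (2 * L / \<alpha>\<^sup>2 * P) * (M * a\<^sup>2 + Q * K)"
    proof (rule mult_mono)
      have "p \<le> P"
        using integral_subset_le[of "{0..\<tau>}" "{0..T}" "\<lambda>r. norm (l1' r)"]
          integral_subset_le[of "{0..\<tau>}" "{0..T}" "\<lambda>r. norm (l2' r)"]
          rate_integrable(2)[OF ev1] rate_integrable(2)[OF ev2] P \<tau> t unfolding p_def by simp
      then show "exp (2 * L / \<alpha>\<^sup>2 * p) \<le> exp (2 * L / \<alpha>\<^sup>2 * P)"
        using L by (simp add: mult_left_mono divide_right_mono)
      have "n \<le> N"
        unfolding n_def N_def using \<tau> t rate_diff_integrable by (intro integral_subset_le) auto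
      moreover have n0: "0 \<le> n"
        unfolding n_def using rate_diff_integrable \<tau> t by (intro integral_nonneg) auto
      ultimately show "M * a\<^sup>2 + (4 * norm (l1 0 - l2 0) + 4 * n) * K \<le> M * a\<^sup>2 + Q * K"
        using initial K0 unfolding Q_def a_def by (intro add_left_mono mult_right_mono) auto
      show "0 \<le> M * a\<^sup>2 + (4 * norm (l1 0 - l2 0) + 4 * n) * K"
        using M K0 n0 by simp
    qed simp
    finally have "(norm (y1 \<tau> - y2 \<tau>))\<^sup>2 \<le> A * (M * a\<^sup>2 + Q * K)"
      using \<alpha> by (simp add: A field_simps)
    then show ?thesis
      by (rule real_le_rsqrt)
  qed
  then have "K \<le> sqrt (A * (M * a\<^sup>2 + Q * K))"
    unfolding K_def using t by (intro cSUP_least) auto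
  then have "K\<^sup>2 \<le> (sqrt (A * (M * a\<^sup>2 + Q * K)))\<^sup>2"
    using K0 by (rule power_mono)
  also have "\<dots> = A * (M * a\<^sup>2 + Q * K)"
    using A0 M K0 N0 a0 by (simp add: Q_def)
  finally have K2: "K\<^sup>2 \<le> A * (M * a\<^sup>2 + Q * K)" .
  \<comment> \<open>Young's inequality: after doubling \<open>K2\<close>, one copy of
    \<open>K\<^sup>2\<close> is absorbed on the left.\<close>
  have "2 * (A * Q) * K \<le> (A * Q)\<^sup>2 + K\<^sup>2"
    by (rule sum_squares_bound)
  with K2 have "K\<^sup>2 \<le> 2 * A * M * a\<^sup>2 + A\<^sup>2 * Q\<^sup>2"
    by (simp add: algebra_simps power_mult_distrib)
  \<comment> \<open>The 32 is the squared factor 4 of \<open>Q\<close> times the 2 from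
    \<open>(x + y)\<^sup>2 \<le> 2 * (x\<^sup>2 + y\<^sup>2)\<close>.\<close>
  also have "A\<^sup>2 * Q\<^sup>2 \<le> A\<^sup>2 * (32 * M\<^sup>2 * a\<^sup>2 + 32 * N\<^sup>2)"
  proof (rule mult_left_mono)
    have "2 * (M * a) * N \<le> (M * a)\<^sup>2 + N\<^sup>2"
      by (rule sum_squares_bound)
    then show "Q\<^sup>2 \<le> 32 * M\<^sup>2 * a\<^sup>2 + 32 * N\<^sup>2"
      by (simp add: Q_def power2_sum power_mult_distrib algebra_simps)
  qed simp
  also have "2 * A * M * a\<^sup>2 + A\<^sup>2 * (32 * M\<^sup>2 * a\<^sup>2 + 32 * N\<^sup>2)
      \<le> (2 * A * M + 32 * A\<^sup>2 * M\<^sup>2 + 32 * A\<^sup>2) * (a\<^sup>2 + N\<^sup>2)"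
  proof -
    have "0 \<le> 2 * A * M * N\<^sup>2 + 32 * A\<^sup>2 * M\<^sup>2 * N\<^sup>2 + 32 * A\<^sup>2 * a\<^sup>2"
      using A0 M by simp
    then show ?thesis by (simp add: algebra_simps)
  qed
  finally have "K\<^sup>2 \<le> (2 * A * M + 32 * A\<^sup>2 * M\<^sup>2 + 32 * A\<^sup>2) * (a\<^sup>2 + N\<^sup>2)"
    by simp
  moreover have "(norm (y1 t - y2 t))\<^sup>2 \<le> K\<^sup>2"
    using le_K[of t] t by (intro power_mono) auto
  ultimately show ?thesis
    by (simp add: a_def N_def)
qed

end

end

section \<open>Elastoplastic energies\<close>

lemma subspace_Msym: "subspace Msym"
  by (rule subspaceI) (auto simp: Msym_def transpose_def vec_eq_iff)

lemma subspace_Mdev: "subspace Mdev"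
  unfolding Mdev_def
  by (rule subspaceI)
    (auto simp: trace_def sum.distrib sum_distrib_left[symmetric] intro: subspace_add subspace_scale subspace_0 subspace_Msym)

lemma Mdev_in_Msym: "z \<in> Mdev \<Longrightarrow> z \<in> Msym"
  by (simp add: Mdev_def)

lemma mat_1_in_Msym: "(mat 1 :: mat3) \<in> Msym"
  by (simp add: Msym_def)

lemma mat_1_nonzero: "(mat 1 :: mat3) \<noteq> 0"
  by (auto simp: mat_def vec_eq_iff)

text \<open>The nonzero vector forces the bounds \<open>M\<close> and \<open>L\<close> to be nonnegative.\<close>

lemma smooth_on_subspaceI:
  assumes "subspace V" "v \<in> V" "v \<noteq> 0"
    and "has_hessian_on f H V" "hessian_bound H V M" "hessian_lipschitz H V L"
  obtains G where "smooth_on_subspace V f G H M L" "\<And>x. x \<in> V \<Longrightarrow> G x \<in> V"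
proof -
  from assms(4) obtain G where G: "\<And>x. x \<in> V \<Longrightarrow> G x \<in> V"
    "\<And>x. x \<in> V \<Longrightarrow> (f has_derivative (\<lambda>h. G x \<bullet> h)) (at x within V)"
    "\<And>x. x \<in> V \<Longrightarrow> (G has_derivative H x) (at x within V)"
    unfolding has_hessian_on_def by blast
  have v: "0 < norm v" "0 \<in> V"
    using assms subspace_0 by auto
  have "0 \<le> M * norm v"
    using assms(2,5) norm_ge_zero order_trans unfolding hessian_bound_def by meson
  then have "0 \<le> M"
    using v by (simp add: zero_le_mult_iff)
  have "0 \<le> L * norm (v - 0) * norm v"
    using assms(2,6) v(2) norm_ge_zero order_trans unfolding hessian_lipschitz_def by meson
  then have "0 \<le> L"
    using v by (simp add: zero_le_mult_iff)
  have "smooth_on_subspace V f G H M L"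
    by unfold_locales
      (use assms G \<open>0 \<le> M\<close> \<open>0 \<le> L\<close> in \<open>auto simp: hessian_bound_def hessian_lipschitz_def\<close>)
  then show ?thesis
    using that G(1) by blast
qed

lemma Mdev_nonzero: "\<exists>v\<in>Mdev. v \<noteq> 0"
proof
  let ?v = "(\<chi> i j. if i = j then 0 else 1) :: mat3"
  show "?v \<in> Mdev"
    by (auto simp: Mdev_def Msym_def transpose_def trace_def vec_eq_iff)
  have "?v $ 1 $ 2 \<noteq> 0"
    by simp
  then show "?v \<noteq> 0"
    by (metis zero_index)
qed

section \<open>Strong convexity of the elastoplastic energy\<close>

lemma hardening_minorant:
  assumes "hardening_potential c2 F"
  obtains g where "\<And>z h. \<lbrakk>z \<in> Mdev; h \<in> Mdev\<rbrakk> \<Longrightarrow> F z + g z \<bullet> h + c2 / 2 * (norm h)\<^sup>2 \<le> F (z + h)"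
proof -
  from assms obtain H M L where H: "has_hessian_on F H Mdev" "hessian_bound H Mdev M" "hessian_lipschitz H Mdev L"
    and ge: "\<And>z h. \<lbrakk>z \<in> Mdev; h \<in> Mdev\<rbrakk> \<Longrightarrow> c2 * (norm h)\<^sup>2 \<le> H z h \<bullet> h"
    unfolding hardening_potential_def by blast
  obtain v where "v \<in> Mdev" "v \<noteq> 0"
    using Mdev_nonzero by blast
  then obtain g where "smooth_on_subspace Mdev F g H M L"
    using smooth_on_subspaceI[OF subspace_Mdev _ _ H] by blast
  then interpret smooth_on_subspace Mdev F g H M L .
  show ?thesis
    using that strongly_convex_if_hessian_ge ge by blast
qed

text \<open>The elastic part is quadratic and expands exactly. As \<open>C\<close> is nonnegative,
  the second-order terms dominate half of the form in \<open>ellipticity_constant\<close>, which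
  gives \<open>\<alpha> / 2\<close>.\<close>

lemma energy_minorant:
  assumes C: "elasticity_tensor C" and \<alpha>: "ellipticity_constant C c2 \<alpha>"
    and g: "\<And>z h. \<lbrakk>z \<in> Mdev; h \<in> Mdev\<rbrakk> \<Longrightarrow> F z + g z \<bullet> h + c2 / 2 * (norm h)\<^sup>2 \<le> F (z + h)"
    and V: "e \<in> Msym" "z \<in> Mdev" "h \<in> Msym" "k \<in> Mdev"
  shows "energy C F (e, z) + (C (e - z) \<bullet> (h - k) + g z \<bullet> k) + \<alpha> / 2 * (norm (h, k))\<^sup>2
    \<le> energy C F (e + h, z + k)"
proof -
  let ?a = "e - z" and ?b = "h - k"
  have ab: "?a \<in> Msym" "?b \<in> Msym"
    using V by (auto intro: subspace_diff[OF subspace_Msym] Mdev_in_Msym)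
  have "C ?b \<bullet> ?a = C ?a \<bullet> ?b" "C (?a + ?b) = C ?a + C ?b" and b0: "0 \<le> C ?b \<bullet> ?b"
    using C ab unfolding elasticity_tensor_def by (metis inner_commute, blast, metis inner_zero_right order_le_less)
  then have "C (?a + ?b) \<bullet> (?a + ?b) = C ?a \<bullet> ?a + 2 * (C ?a \<bullet> ?b) + C ?b \<bullet> ?b"
    by (simp add: inner_add_left inner_add_right)
  moreover have eq: "(e + h) - (z + k) = ?a + ?b"
    by simp
  moreover have "F z + g z \<bullet> k + c2 / 2 * (norm k)\<^sup>2 \<le> F (z + k)"
    using g V by blast
  moreover have "\<alpha> * ((norm h)\<^sup>2 + (norm k)\<^sup>2) \<le> 1 / 2 * (C ?b \<bullet> ?b) + c2 * (norm k)\<^sup>2"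
    using \<alpha> V unfolding ellipticity_constant_def by blast
  moreover have "(norm (h, k))\<^sup>2 = (norm h)\<^sup>2 + (norm k)\<^sup>2"
    by (simp add: norm_Pair)
  ultimately show ?thesis
    using b0 unfolding energy_def prod.case eq by (simp add: field_simps)
qed

text \<open>\<open>G\<close> is known only as some gradient of the energy;
  \<open>gradient_eq_if_minorant\<close> identifies its pairing with \<open>h\<close> as the slope
  \<open>p h\<close> of the explicit minorant, without differentiating the energy.\<close>

lemma energy_strongly_convex:
  assumes C: "elasticity_tensor C" and F: "hardening_potential c2 F" and \<alpha>: "ellipticity_constant C c2 \<alpha>"
    and "smooth_on_subspace (Msym \<times> Mdev) (energy C F) G H M L"
    and x: "x \<in> Msym \<times> Mdev" and h: "h \<in> Msym \<times> Mdev"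
  shows "energy C F x + G x \<bullet> h + \<alpha> / 2 * (norm h)\<^sup>2 \<le> energy C F (x + h)"
proof -
  interpret smooth_on_subspace "Msym \<times> Mdev" "energy C F" G H M L by fact
  obtain g where g: "\<And>z h. \<lbrakk>z \<in> Mdev; h \<in> Mdev\<rbrakk> \<Longrightarrow> F z + g z \<bullet> h + c2 / 2 * (norm h)\<^sup>2 \<le> F (z + h)"
    using hardening_minorant[OF F] by blast
  define p where "p k = C (fst x - snd x) \<bullet> (fst k - snd k) + g (snd x) \<bullet> snd k" for k
  have minorant: "energy C F x + p k + \<alpha> / 2 * (norm k)\<^sup>2 \<le> energy C F (x + k)" if "k \<in> Msym \<times> Mdev" for k
    using energy_minorant[OF C \<alpha> g, of "fst x" "snd x" "fst k" "snd k"] x that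
    by (auto simp: p_def)
  have "G x \<bullet> h = p h"
  proof (rule gradient_eq_if_minorant[OF x h])
    fix s
    have "p (s *\<^sub>R h) = s * p h"
      by (simp add: p_def inner_diff_right algebra_simps)
    moreover have "0 \<le> \<alpha> / 2 * (norm (s *\<^sub>R h))\<^sup>2"
      using \<alpha> by (simp add: ellipticity_constant_def)
    ultimately show "energy C F x + s * p h \<le> energy C F (x + s *\<^sub>R h)"
      using minorant[of "s *\<^sub>R h"] in_V(3)[OF h, of s] by linarith
  qed
  then show ?thesis
    using minorant[OF h] by simp
qed

section \<open>Dissipation and energy on subintervals\<close>

text \<open>Appending \<open>t\<close> to a partition that ends at \<open>s\<close> adds exactly the
  term \<open>D (z t - z s)\<close>.\<close>

lemma Diss_increment:
  assumes "s \<le> t" and ds: "Diss D z a s = ereal ds" and dt: "Diss D z a t = ereal dt"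
  shows "ds + D (z t - z s) \<le> dt"
proof -
  have "Diss D z a s \<le> ereal (dt - D (z t - z s))"
    unfolding Diss_def
  proof (rule SUP_least, clarify)
    fix N and p :: "nat \<Rightarrow> real"
    assume p: "a = p 0" "s = p N" "\<forall>i<N. p i \<le> p (Suc i)"
    define p' where "p' i = (if i \<le> N then p i else t)" for i
    have "(Suc N, p') \<in> {(N :: nat, p :: nat \<Rightarrow> real). p 0 = a \<and> p N = t \<and> (\<forall>i<N. p i \<le> p (Suc i))}"
      using p \<open>s \<le> t\<close> by (auto simp: p'_def less_Suc_eq)
    then have "ereal (\<Sum>i=1..Suc N. D (z (p' i) - z (p' (i - 1)))) \<le> Diss D z a t"
      unfolding Diss_def by (rule SUP_upper2) simp
    moreover have "(\<Sum>i=1..Suc N. D (z (p' i) - z (p' (i - 1))))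
        = (\<Sum>i=1..N. D (z (p i) - z (p (i - 1)))) + D (z t - z s)"
    proof -
      have "(\<Sum>i=1..N. D (z (p' i) - z (p' (i - 1)))) = (\<Sum>i=1..N. D (z (p i) - z (p (i - 1))))"
        by (rule sum.cong) (auto simp: p'_def)
      then show ?thesis
        by (simp add: p'_def p(2))
    qed
    ultimately show "ereal (\<Sum>i=1..N. D (z (p i) - z (p (i - 1)))) \<le> ereal (dt - D (z t - z (p N)))"
      using dt p by simp
  qed
  then show ?thesis
    using ds by simp
qed

lemma energetic_solution_stable:
  "\<lbrakk>energetic_solution C F D T \<sigma> \<sigma>' e0 z0 e z; t \<in> {0..T}\<rbrakk> \<Longrightarrow> (e t, z t) \<in> stable_set C F D (\<sigma> t)"
  by (simp add: energetic_solution_def)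

lemma stable_setD:
  "\<lbrakk>(e, z) \<in> stable_set C F D \<tau>; e' \<in> Msym; z' \<in> Mdev\<rbrakk> \<Longrightarrow>
    energy C F (e, z) - \<tau> \<bullet> e \<le> energy C F (e', z') - \<tau> \<bullet> e' + D (z' - z)"
  by (simp add: stable_set_def)

text \<open>The balances at \<open>s\<close> and \<open>t\<close> are subtracted, and the
  dissipation in between is bounded below by that of the single increment.\<close>

lemma energetic_solution_increment:
  assumes sol: "energetic_solution C F D T \<sigma> \<sigma>' e0 z0 e z" and st: "0 \<le> s" "s \<le> t" "t \<le> T"
  shows "energy C F (e t, z t) - \<sigma> t \<bullet> e t + D (z t - z s)
    \<le> energy C F (e s, z s) - \<sigma> s \<bullet> e s - integral {s..t} (\<lambda>r. \<sigma>' r \<bullet> e r)"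
proof -
  define E where "E r = energy C F (e r, z r) - \<sigma> r \<bullet> e r" for r
  define I where "I r = integral {0..r} (\<lambda>r. \<sigma>' r \<bullet> e r)" for r
  define E0 where "E0 = energy C F (e0, z0) - \<sigma> 0 \<bullet> e0"
  have Diss: "Diss D z 0 r = ereal (E0 - I r - E r)" if "0 \<le> r" "r \<le> T" for r
  proof -
    have "ereal (E r) + Diss D z 0 r = ereal (E0 - I r)"
      using sol that unfolding energetic_solution_def E_def I_def E0_def by auto
    \<comment> \<open>Infinite values are excluded because the other terms of the balance are
      finite.\<close>
    then show ?thesis
      by (cases "Diss D z 0 r") auto
  qed
  have int: "(\<lambda>r. \<sigma>' r \<bullet> e r) integrable_on {0..T}"
    using sol by (simp add: energetic_solution_def absolutely_integrable_on_def)
  have "I s + integral {s..t} (\<lambda>r. \<sigma>' r \<bullet> e r) = I t"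
    unfolding I_def
    by (rule Henstock_Kurzweil_Integration.integral_combine[OF st(1,2)], rule integrable_on_subinterval[OF int])
      (use st in auto)
  moreover have "(E0 - I s - E s) + D (z t - z s) \<le> E0 - I t - E t"
    using st by (intro Diss_increment[of s t D z 0] Diss) auto
  ultimately show ?thesis
    by (simp add: E_def)
qed

lemma W11_norm_ge:
  assumes "g absolutely_integrable_on {0..t}" and "continuous_on {0..t} u"
  shows "integral {0..t} (\<lambda>s. norm (g s)) \<le> W11_norm t u g"
  unfolding W11_norm_def
  using assms by (auto intro!: integral_nonneg integrable_continuous_real continuous_intros)


lemma absolutely_integrable_Pair_0:
  fixes g :: "real \<Rightarrow> 'a::euclidean_space"
  assumes "g absolutely_integrable_on S"
  shows "(\<lambda>s. (g s, 0 :: 'b::euclidean_space)) absolutely_integrable_on S"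
  using absolutely_integrable_linear[OF assms, of "\<lambda>x. (x, 0 :: 'b)"]
  by (simp add: o_def bounded_linear_Pair bounded_linear_ident bounded_linear_zero)

lemma integral_Pair_0:
  fixes g :: "real \<Rightarrow> 'a::euclidean_space"
  assumes "g integrable_on S"
  shows "integral S (\<lambda>s. (g s, 0 :: 'b::euclidean_space)) = (integral S g, 0)"
  using integral_linear[OF assms, of "\<lambda>x. (x, 0 :: 'b)"]
  by (simp add: o_def bounded_linear_Pair bounded_linear_ident bounded_linear_zero)

section \<open>Energetic solutions as abstract evolutions\<close>

text \<open>Only the second component of a state dissipates. \<open>G_in\<close> makes the
  difference between the stress and the strain component of the gradient an admissible test
  direction.\<close>

locale elastoplastic = convex_evolution "Msym \<times> Mdev" "energy C F" G H M L \<alpha> "\<lambda>y. D (snd y)"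
  for C :: "mat3 \<Rightarrow> mat3" and F :: "mat3 \<Rightarrow> real" and G H M L \<alpha> and D :: "mat3 \<Rightarrow> real" +
  assumes G_in: "x \<in> Msym \<times> Mdev \<Longrightarrow> G x \<in> Msym \<times> Mdev"
begin

lemma D_0: "D 0 = 0"
proof -
  have "(0 :: mat3, 0 :: mat3) \<in> Msym \<times> Mdev"
    using in_V(5) by (simp add: zero_prod_def)
  from D_scale[OF this, of 2] show ?thesis by simp
qed

text \<open>Changing the strain alone dissipates nothing. Testing the force with its own strain
  component \<open>?k\<close> bounds the square of that component by \<open>D 0 = 0\<close>.\<close>

lemma stress_eq_gradient:
  assumes "(e, z) \<in> stable_set C F D \<tau>" and \<tau>: "\<tau> \<in> Msym"
  shows "fst (G (e, z)) = \<tau>"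
proof -
  have ez: "(e, z) \<in> Msym \<times> Mdev"
    using assms(1) by (auto simp: stable_set_def)
  have le: "((\<tau>, 0) - G (e, z)) \<bullet> h \<le> D (snd h)" if "h \<in> Msym \<times> Mdev" for h
  proof (rule stable_force[OF ez that])
    fix h :: "mat3 \<times> mat3" assume "h \<in> Msym \<times> Mdev"
    then show "energy C F (e, z) - (\<tau>, 0) \<bullet> (e, z)
        \<le> energy C F ((e, z) + h) - (\<tau>, 0) \<bullet> ((e, z) + h) + D (snd h)"
      using stable_setD[OF assms(1), of "e + fst h" "z + snd h"] in_V(1)[OF ez, of h] by (cases h) simp
  qed
  let ?k = "\<tau> - fst (G (e, z))"
  have "?k \<in> Msym"
    using G_in[OF ez] \<tau> by (auto intro: subspace_diff[OF subspace_Msym])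
  then have "((\<tau>, 0) - G (e, z)) \<bullet> (?k, 0) \<le> 0"
    using le[of "(?k, 0)"] D_0 subspace_0[OF subspace_Mdev] by simp
  then have "?k \<bullet> ?k \<le> 0"
    by (cases "G (e, z)") simp
  then have "?k = 0"
    by (metis inner_eq_zero_iff inner_ge_zero order_antisym)
  then show ?thesis by simp
qed

text \<open>The stress acts on the strain only, so the loads get a zero second component;
  \<open>weak_derivative_increment\<close> turns the weak derivative into the integral form.\<close>

lemma evolution_if_energetic_solution:
  assumes \<sigma>: "W11_sym T \<sigma> \<sigma>'" and "0 < T" and sol: "energetic_solution C F D T \<sigma> \<sigma>' e0 z0 e z"
  shows "evolution T (\<lambda>t. (\<sigma> t, 0)) (\<lambda>t. (\<sigma>' t, 0)) (\<lambda>t. (e t, z t))"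
  unfolding evolution_def
proof (intro conjI ballI allI impI)
  have \<sigma>': "\<sigma>' absolutely_integrable_on {0..T}" and cont: "continuous_on {0..T} \<sigma>" and weak: "weak_derivative T \<sigma> \<sigma>'"
    using \<sigma> by (simp_all add: W11_sym_def)
  show "(\<lambda>t. (\<sigma>' t, 0 :: mat3)) absolutely_integrable_on {0..T}"
    by (rule absolutely_integrable_Pair_0[OF \<sigma>'])
  show "(\<lambda>s. (\<sigma>' s, 0) \<bullet> (e s, z s)) absolutely_integrable_on {0..T}"
    using sol by (simp add: energetic_solution_def)
  show ez: "(e t, z t) \<in> Msym \<times> Mdev" if "t \<in> {0..T}" for t
    using sol that by (simp add: energetic_solution_def)
  show "(\<sigma> t, 0 :: mat3) - (\<sigma> s, 0) = integral {s..t} (\<lambda>t. (\<sigma>' t, 0))" if st: "0 \<le> s" "s \<le> t" "t \<le> T" for s t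
  proof -
    have "\<sigma>' integrable_on {0..T}"
      using \<sigma>' by (simp add: absolutely_integrable_on_def)
    then have "\<sigma>' integrable_on {s..t}"
      by (rule integrable_on_subinterval) (use st in auto)
    then show ?thesis
      using weak_derivative_increment[OF cont \<sigma>' weak \<open>0 < T\<close> st] by (simp add: integral_Pair_0)
  qed
  show "energy C F (e t, z t) - (\<sigma> t, 0) \<bullet> (e t, z t)
      \<le> energy C F ((e t, z t) + h) - (\<sigma> t, 0) \<bullet> ((e t, z t) + h) + D (snd h)"
    if t: "t \<in> {0..T}" and h: "h \<in> Msym \<times> Mdev" for t h
  proof -
    have "e t + fst h \<in> Msym" "z t + snd h \<in> Mdev"
      using in_V(1)[OF ez[OF t] h] by (cases h; simp)+
    from stable_setD[OF energetic_solution_stable[OF sol t] this]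
    have "energy C F (e t, z t) - \<sigma> t \<bullet> e t
        \<le> energy C F (e t + fst h, z t + snd h) - \<sigma> t \<bullet> (e t + fst h) + D (z t + snd h - z t)" .
    then show ?thesis
      by (cases h) simp
  qed
  show "energy C F (e t, z t) - (\<sigma> t, 0) \<bullet> (e t, z t) + D (snd ((e t, z t) - (e s, z s)))
      \<le> energy C F (e s, z s) - (\<sigma> s, 0) \<bullet> (e s, z s) - integral {s..t} (\<lambda>r. (\<sigma>' r, 0) \<bullet> (e r, z r))"
    if "0 \<le> s" "s \<le> t" "t \<le> T" for s t
    using energetic_solution_increment[OF sol that] by simp
qed

lemma energetic_solution_stability:
  assumes "0 < T" and \<sigma>1: "W11_sym T \<sigma>1 \<sigma>1'" and \<sigma>2: "W11_sym T \<sigma>2 \<sigma>2'"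
    and sol1: "energetic_solution C F D T \<sigma>1 \<sigma>1' e01 z01 e1 z1"
    and sol2: "energetic_solution C F D T \<sigma>2 \<sigma>2' e02 z02 e2 z2"
    and t: "t \<in> {0..T}"
    and A: "A = exp (2 * L / \<alpha>\<^sup>2 * (W11_norm T \<sigma>1 \<sigma>1' + W11_norm T \<sigma>2 \<sigma>2')) / \<alpha>"
  shows "(norm (e1 t - e2 t))\<^sup>2 + (norm (z1 t - z2 t))\<^sup>2
    \<le> (2 * A * M + 32 * A\<^sup>2 * M\<^sup>2 + 32 * A\<^sup>2) *
      ((norm (e01 - e02))\<^sup>2 + (norm (z01 - z02))\<^sup>2
        + (W11_norm t (\<lambda>s. \<sigma>1 s - \<sigma>2 s) (\<lambda>s. \<sigma>1' s - \<sigma>2' s))\<^sup>2)"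
proof -
  define n where "n = integral {0..t} (\<lambda>r. norm (\<sigma>1' r - \<sigma>2' r))"
  define W where "W = W11_norm t (\<lambda>s. \<sigma>1 s - \<sigma>2 s) (\<lambda>s. \<sigma>1' s - \<sigma>2' s)"
  have abs: "\<sigma>1' absolutely_integrable_on {0..T}" "\<sigma>2' absolutely_integrable_on {0..T}"
    and cont: "continuous_on {0..T} \<sigma>1" "continuous_on {0..T} \<sigma>2"
    and sym: "\<sigma>1 0 \<in> Msym" "\<sigma>2 0 \<in> Msym"
    using \<sigma>1 \<sigma>2 \<open>0 < T\<close> by (simp_all add: W11_sym_def)
  have init: "e1 0 = e01" "z1 0 = z01" "e2 0 = e02" "z2 0 = z02"
    using sol1 sol2 by (simp_all add: energetic_solution_def)
  have stab0: "(e1 0, z1 0) \<in> stable_set C F D (\<sigma>1 0)" "(e2 0, z2 0) \<in> stable_set C F D (\<sigma>2 0)"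
    using energetic_solution_stable[OF sol1, of 0] energetic_solution_stable[OF sol2, of 0] \<open>0 < T\<close> by simp_all
  have V0: "(e01, z01) \<in> Msym \<times> Mdev" "(e02, z02) \<in> Msym \<times> Mdev"
    using stab0 by (auto simp: stable_set_def init)
  \<comment> \<open>Stability at time 0 provides the bound on the initial loads that
    \<open>evolution_stability\<close> requires.\<close>
  have "\<sigma>1 0 - \<sigma>2 0 = fst (G (e01, z01) - G (e02, z02))"
    using stress_eq_gradient[OF stab0(1) sym(1)] stress_eq_gradient[OF stab0(2) sym(2)] by (simp add: init)
  also have "norm \<dots> \<le> norm (G (e01, z01) - G (e02, z02))"
    by (metis norm_fst_le prod.collapse)
  also have "\<dots> \<le> M * norm ((e01, z01) - (e02, z02))"
    by (rule G_lipschitz[OF V0])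
  finally have initial: "norm ((\<sigma>1 0, 0 :: mat3) - (\<sigma>2 0, 0)) \<le> M * norm ((e1 0, z1 0) - (e2 0, z2 0))"
    by (simp add: init norm_Pair)
  have P: "integral {0..T} (\<lambda>r. norm (\<sigma>1' r, 0 :: mat3)) + integral {0..T} (\<lambda>r. norm (\<sigma>2' r, 0 :: mat3))
      \<le> W11_norm T \<sigma>1 \<sigma>1' + W11_norm T \<sigma>2 \<sigma>2'"
    using W11_norm_ge[OF abs(1) cont(1)] W11_norm_ge[OF abs(2) cont(2)] by (simp add: norm_Pair)
  have "(norm ((e1 t, z1 t) - (e2 t, z2 t)))\<^sup>2 \<le> (2 * A * M + 32 * A\<^sup>2 * M\<^sup>2 + 32 * A\<^sup>2) *
    ((norm ((e1 0, z1 0) - (e2 0, z2 0)))\<^sup>2 + (integral {0..t} (\<lambda>r. norm ((\<sigma>1' r, 0 :: mat3) - (\<sigma>2' r, 0))))\<^sup>2)"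
    by (rule evolution_stability[OF evolution_if_energetic_solution[OF \<sigma>1 \<open>0 < T\<close> sol1]
        evolution_if_energetic_solution[OF \<sigma>2 \<open>0 < T\<close> sol2] t initial P A])
  then have "(norm (e1 t - e2 t))\<^sup>2 + (norm (z1 t - z2 t))\<^sup>2 \<le> (2 * A * M + 32 * A\<^sup>2 * M\<^sup>2 + 32 * A\<^sup>2) *
      ((norm (e01 - e02))\<^sup>2 + (norm (z01 - z02))\<^sup>2 + n\<^sup>2)"
    by (simp add: norm_Pair init n_def)
  \<comment> \<open>Only the rates occur so far; the Sobolev norm adds the nonnegative integral of
    the load difference.\<close>
  also have "\<dots> \<le> (2 * A * M + 32 * A\<^sup>2 * M\<^sup>2 + 32 * A\<^sup>2) *
      ((norm (e01 - e02))\<^sup>2 + (norm (z01 - z02))\<^sup>2 + W\<^sup>2)"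
  proof (intro mult_left_mono add_left_mono power_mono)
    have d: "(\<lambda>r. \<sigma>1' r - \<sigma>2' r) absolutely_integrable_on {0..t}"
      using abs t by (intro set_integral_diff) (auto intro: absolutely_integrable_on_subinterval)
    have "continuous_on {0..t} (\<lambda>s. \<sigma>1 s - \<sigma>2 s)"
      using cont t by (intro continuous_on_diff) (auto intro: continuous_on_subset)
    then show "n \<le> W"
      unfolding n_def W_def by (rule W11_norm_ge[OF d])
    show "0 \<le> n"
      unfolding n_def using d by (intro integral_nonneg) (auto simp: absolutely_integrable_on_def)
    show "0 \<le> 2 * A * M + 32 * A\<^sup>2 * M\<^sup>2 + 32 * A\<^sup>2"
      using M \<alpha> by (simp add: A)
  qed
  finally show ?thesis
    by (simp add: W_def)
qed

end

section \<open>The stability estimate and its constant\<close>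

text \<open>Choosing \<open>c\<close> as a function before all other data are quantified expresses
  that the constant depends on its five arguments only.\<close>

theorem theorem3p4:
  shows "\<exists>c :: real \<Rightarrow> real \<Rightarrow> real \<Rightarrow> real \<Rightarrow> real \<Rightarrow> real.
    (\<forall>\<alpha> M L N1 N2. 0 < c \<alpha> M L N1 N2) \<and>
    (\<forall>(C :: mat3 \<Rightarrow> mat3) (c2 :: real) (F :: real \<Rightarrow> mat3 \<Rightarrow> real) (D :: mat3 \<Rightarrow> real)
       (\<rho> :: real) (\<alpha> :: real) (H :: mat3 \<times> mat3 \<Rightarrow> mat3 \<times> mat3 \<Rightarrow> mat3 \<times> mat3) (M :: real) (L :: real)
       (T :: real) (\<sigma>1 :: real \<Rightarrow> mat3) (\<sigma>1' :: real \<Rightarrow> mat3) (\<sigma>2 :: real \<Rightarrow> mat3) (\<sigma>2' :: real \<Rightarrow> mat3)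
       (e01 :: mat3) (z01 :: mat3) (e02 :: mat3) (z02 :: mat3)
       (e1 :: real \<Rightarrow> mat3) (z1 :: real \<Rightarrow> mat3) (e2 :: real \<Rightarrow> mat3) (z2 :: real \<Rightarrow> mat3).
       elasticity_tensor C \<and> 0 < c2 \<and> (\<forall>r>0. hardening_potential c2 (F r)) \<and>
       dissipation_potential D \<and> ellipticity_constant C c2 \<alpha> \<and>
       0 < \<rho> \<and>
       has_hessian_on (energy C (F \<rho>)) H (Msym \<times> Mdev) \<and>
       hessian_bound H (Msym \<times> Mdev) M \<and> hessian_lipschitz H (Msym \<times> Mdev) L \<and>
       0 < T \<and> W11_sym T \<sigma>1 \<sigma>1' \<and> W11_sym T \<sigma>2 \<sigma>2' \<and>
       (e01, z01) \<in> stable_set C (F \<rho>) D (\<sigma>1 0) \<and>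
       (e02, z02) \<in> stable_set C (F \<rho>) D (\<sigma>2 0) \<and>
       energetic_solution C (F \<rho>) D T \<sigma>1 \<sigma>1' e01 z01 e1 z1 \<and>
       energetic_solution C (F \<rho>) D T \<sigma>2 \<sigma>2' e02 z02 e2 z2 \<longrightarrow>
       (\<forall>t\<in>{0..T}.
          (norm (e1 t - e2 t))\<^sup>2 + (norm (z1 t - z2 t))\<^sup>2
            \<le> c \<alpha> M L (W11_norm T \<sigma>1 \<sigma>1') (W11_norm T \<sigma>2 \<sigma>2') *
               ((norm (e01 - e02))\<^sup>2 + (norm (z01 - z02))\<^sup>2
                + (W11_norm t (\<lambda>s. \<sigma>1 s - \<sigma>2 s) (\<lambda>s. \<sigma>1' s - \<sigma>2' s))\<^sup>2)))"
proof -
  define A where "A \<alpha> L N = exp (2 * L / \<alpha>\<^sup>2 * N) / \<alpha>" for \<alpha> L N :: real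
  define k where "k \<alpha> M L N = 2 * A \<alpha> L N * M + 32 * (A \<alpha> L N)\<^sup>2 * M\<^sup>2 + 32 * (A \<alpha> L N)\<^sup>2" for \<alpha> M L N
  have main: "(norm (e1 t - e2 t))\<^sup>2 + (norm (z1 t - z2 t))\<^sup>2
      \<le> (1 + \<bar>k \<alpha> M L (W11_norm T \<sigma>1 \<sigma>1' + W11_norm T \<sigma>2 \<sigma>2')\<bar>) *
        ((norm (e01 - e02))\<^sup>2 + (norm (z01 - z02))\<^sup>2
          + (W11_norm t (\<lambda>s. \<sigma>1 s - \<sigma>2 s) (\<lambda>s. \<sigma>1' s - \<sigma>2' s))\<^sup>2)"
    if C: "elasticity_tensor C" and F: "\<forall>r>0. hardening_potential c2 (F r)"
      and D: "dissipation_potential D" and \<alpha>: "ellipticity_constant C c2 \<alpha>" and \<rho>: "0 < \<rho>"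
      and H: "has_hessian_on (energy C (F \<rho>)) H (Msym \<times> Mdev)"
        "hessian_bound H (Msym \<times> Mdev) M" "hessian_lipschitz H (Msym \<times> Mdev) L"
      and T: "0 < T" and \<sigma>: "W11_sym T \<sigma>1 \<sigma>1'" "W11_sym T \<sigma>2 \<sigma>2'"
      and sol: "energetic_solution C (F \<rho>) D T \<sigma>1 \<sigma>1' e01 z01 e1 z1"
        "energetic_solution C (F \<rho>) D T \<sigma>2 \<sigma>2' e02 z02 e2 z2"
      and t: "t \<in> {0..T}"
    for C c2 D \<rho> \<alpha> H M L T \<sigma>1 \<sigma>1' \<sigma>2 \<sigma>2' e01 z01 e02 z02 e1 z1 e2 z2 t and F :: "real \<Rightarrow> mat3 \<Rightarrow> real"
  proof -
    \<comment> \<open>The nonzero vector from which \<open>smooth_on_subspaceI\<close> derives the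
      signs of \<open>M\<close> and \<open>L\<close>.\<close>
    have "(mat 1 :: mat3, 0 :: mat3) \<in> Msym \<times> Mdev" "(mat 1 :: mat3, 0 :: mat3) \<noteq> 0"
      using mat_1_in_Msym mat_1_nonzero subspace_0[OF subspace_Mdev] by (auto simp: zero_prod_def)
    then obtain G where G: "smooth_on_subspace (Msym \<times> Mdev) (energy C (F \<rho>)) G H M L"
        "\<And>x. x \<in> Msym \<times> Mdev \<Longrightarrow> G x \<in> Msym \<times> Mdev"
      using smooth_on_subspaceI[OF subspace_Times[OF subspace_Msym subspace_Mdev] _ _ H] by blast
    interpret smooth_on_subspace "Msym \<times> Mdev" "energy C (F \<rho>)" G H M L by (rule G(1))
    interpret elastoplastic C "F \<rho>" G H M L \<alpha> D
    proof unfold_locales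
      show "0 < \<alpha>"
        using \<alpha> by (simp add: ellipticity_constant_def)
      show "energy C (F \<rho>) x + G x \<bullet> h + \<alpha> / 2 * (norm h)\<^sup>2 \<le> energy C (F \<rho>) (x + h)"
        if "x \<in> Msym \<times> Mdev" "h \<in> Msym \<times> Mdev" for x h
        using energy_strongly_convex[OF C _ \<alpha> G(1) that] F \<rho> by blast
      show "D (snd (r *\<^sub>R h)) = r * D (snd h)" if "h \<in> Msym \<times> Mdev" "0 < r" for h r
        using D that by (auto simp: dissipation_potential_def)
    qed (rule G(2))
    let ?N = "W11_norm T \<sigma>1 \<sigma>1' + W11_norm T \<sigma>2 \<sigma>2'"
    let ?R = "(norm (e01 - e02))\<^sup>2 + (norm (z01 - z02))\<^sup>2
      + (W11_norm t (\<lambda>s. \<sigma>1 s - \<sigma>2 s) (\<lambda>s. \<sigma>1' s - \<sigma>2' s))\<^sup>2"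
    have "(norm (e1 t - e2 t))\<^sup>2 + (norm (z1 t - z2 t))\<^sup>2 \<le> k \<alpha> M L ?N * ?R"
      unfolding k_def by (rule energetic_solution_stability[OF T \<sigma> sol t A_def])
    also have "\<dots> \<le> (1 + \<bar>k \<alpha> M L ?N\<bar>) * ?R"
      by (intro mult_right_mono) auto
    finally show "(norm (e1 t - e2 t))\<^sup>2 + (norm (z1 t - z2 t))\<^sup>2 \<le> (1 + \<bar>k \<alpha> M L ?N\<bar>) * ?R" .
  qed
  show ?thesis
  \<comment> \<open>The absolute value and the summand 1 make the constant positive for all
    arguments, including those that no data realize.\<close>
  proof (rule exI[of _ "\<lambda>\<alpha> M L N1 N2. 1 + \<bar>k \<alpha> M L (N1 + N2)\<bar>"], intro conjI allI impI ballI, goal_cases)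
    case 1
    show ?case by simp
  next
    case 2
    then show ?case
      by (elim conjE) (rule main; assumption)
  qed
qed

end
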